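(* Let $E$ and $F$ be (normed) $PL$-spaces. Then the pair $(E\otimes_{pl}F,\vartheta)$, where $\vartheta:E\times F\to E\otimes_{pl}F,\ (x,y)\mapsto x\otimes y$ is the canonical bilinear operator, is a non-completed $PL$-tensor product of $E$ and $F$. That is: $E\otimes_{pl}F$ is a normed $PL$-space, $\vartheta$ is $L$-contractive, and for every normed $PL$-space $G$ and every $L$-bounded bilinear operator $\mathcal{R}:E\times F\to G$ there exists a unique $L$-bounded linear operator $R:E\otimes_{pl}F\to G$ such that $R\circ\vartheta=\mathcal{R}$, and moreover $\|R\|_{lb}=\|\mathcal{R}\|_{lb}$.
   Context: All linear spaces are complex. $H$ is a fixed separable infinite-dimensional Hilbert space, $\mathcal{B}$ is the algebra of bounded operators on $H$ with the operator norm. For a linear space $E$, $HE:=H\otimes E$ (algebraic tensor product), with elementary tensors written $\xi x$; it is a left $\mathcal{B}$-module via $a\cdot(\xi x):=a(\xi)x$. A (semi-)normed $PL$-space is a linear space $E$ together with a (semi-)norm on $HE$ (called a $PL$-(semi-)norm on $E$) such that $\|a\cdot u\|\le\|a\|\|u\|$ for all $a\in\mathcal{B}$, $u\in HE$. A linear operator $\varphi:E\to F$ has amplification $\varphi_\infty:HE\to HF,\ \xi x\mapsto\xi\varphi(x)$; between $PL$-spaces, $\varphi$ is $L$-bounded if $\varphi_\infty$ is bounded, and $\|\varphi\|_{lb}:=\|\varphi_\infty\|$. Fix a unitary isomorphism $\iota$ from the Hilbert tensor product $H\widehat\otimes_{hil}H$ onto $H$, and put $\xi\diamondsuit\eta:=\iota(\xi\otimes\eta)$.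 A bilinear operator $\mathcal{R}:E\times F\to G$ has amplification $\mathcal{R}_\infty:HE\times HF\to HG$, well defined by $\mathcal{R}_\infty(\xi x,\eta y)=(\xi\diamondsuit\eta)\mathcal{R}(x,y)$; between $PL$-spaces, $\mathcal{R}$ is $L$-bounded (resp. $L$-contractive) if $\mathcal{R}_\infty$ is bounded (resp. contractive), and $\|\mathcal{R}\|_{lb}:=\|\mathcal{R}_\infty\|$. For $u\in HE$, $v\in HF$ the element $u\diamondsuit v\in H(E\otimes F)$ is well defined bilinearly by $\xi x\diamondsuit\eta y:=(\xi\diamondsuit\eta)(x\otimes y)$. $E\otimes_{pl}F$ is the linear space $E\otimes F$ equipped with the function on $H(E\otimes F)$ $$\|U\|_{pl}:=\inf\Big\{\sum_{k=1}^n\|a_k\|\|u_k\|\|v_k\|\Big\},$$ the infimum being over all representations $U=\sum_{k=1}^n a_k\cdot(u_k\diamondsuit v_k)$ with $n\in\mathbb{N}$, $a_k\in\mathcal{B}$, $u_k\in HE$, $v_k\in HF$ (such representations always exist). *)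

theory Defs
  imports "HOL-Analysis.Analysis" "HOL-Library.Poly_Mapping"
begin

section \<open>Complex linear spaces and Hilbert spaces\<close>

class complex_vector = ab_group_add +
  fixes scaleC :: "complex \<Rightarrow> 'a \<Rightarrow> 'a" (infixr "*\<^sub>C" 75)
  assumes scaleC_add_right: "c *\<^sub>C (x + y) = c *\<^sub>C x + c *\<^sub>C y"
    and scaleC_add_left: "(c + d) *\<^sub>C x = c *\<^sub>C x + d *\<^sub>C x"
    and scaleC_scaleC: "c *\<^sub>C d *\<^sub>C x = (c * d) *\<^sub>C x"
    and scaleC_one: "1 *\<^sub>C x = x"

global_interpretation complex_vector: vector_space "scaleC :: complex \<Rightarrow> 'a \<Rightarrow> 'a::complex_vector"
  by unfold_locales (simp_all add: scaleC_add_right scaleC_add_left scaleC_scaleC scaleC_one)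

abbreviation clinear :: "('a::complex_vector \<Rightarrow> 'b::complex_vector) \<Rightarrow> bool"
  where "clinear \<equiv> Vector_Spaces.linear scaleC scaleC"

definition cbilinear :: "('a::complex_vector \<Rightarrow> 'b::complex_vector \<Rightarrow> 'c::complex_vector) \<Rightarrow> bool"
  where "cbilinear f \<longleftrightarrow> (\<forall>y. clinear (\<lambda>x. f x y)) \<and> (\<forall>x. clinear (f x))"

text \<open>The inner product is linear in the first argument.\<close>

class chilbert_space = complex_vector + banach +
  fixes cinner :: "'a \<Rightarrow> 'a \<Rightarrow> complex"
  assumes scaleR_scaleC: "scaleR r x = complex_of_real r *\<^sub>C x"
    and cinner_commute: "cinner x y = cnj (cinner y x)"
    and cinner_add_left: "cinner (x + y) z = cinner x z + cinner y z"
    and cinner_scaleC_left: "cinner (c *\<^sub>C x) y = c * cinner x y"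
    and cinner_self: "cinner x x = complex_of_real ((norm x)\<^sup>2)"

text \<open>Membership in \<open>\<B>\<close>. The operator norm of such an \<open>a\<close> is \<^term>\<open>onorm a\<close>.\<close>

definition bounded_clinear :: "('h::chilbert_space \<Rightarrow> 'h) \<Rightarrow> bool"
  where "bounded_clinear a \<longleftrightarrow> clinear a \<and> (\<exists>K. \<forall>x. norm (a x) \<le> K * norm x)"

definition infinite_dimensional :: "'a::complex_vector itself \<Rightarrow> bool"
  where "infinite_dimensional _ \<longleftrightarrow>
    \<not> (\<exists>B. finite B \<and> complex_vector.span B = (UNIV :: 'a set))"

definition unitary :: "('k::chilbert_space \<Rightarrow> 'h::chilbert_space) \<Rightarrow> bool"
  where "unitary U \<longleftrightarrow> clinear U \<and> surj U \<and> (\<forall>x y. cinner (U x) (U y) = cinner x y)"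


section \<open>The algebraic tensor product\<close>

instantiation complex :: complex_vector
begin
definition scaleC_complex :: "complex \<Rightarrow> complex \<Rightarrow> complex" where "scaleC_complex = (*)"
instance by standard (simp_all add: scaleC_complex_def algebra_simps)
end

text \<open>\<open>'a \<Rightarrow>\<^sub>0 complex\<close> is the free complex vector space on \<open>'a\<close>.\<close>

instantiation poly_mapping :: (type, complex_vector) complex_vector
begin
definition scaleC_poly_mapping :: "complex \<Rightarrow> ('a \<Rightarrow>\<^sub>0 'b) \<Rightarrow> ('a \<Rightarrow>\<^sub>0 'b)"
  where "scaleC_poly_mapping c = Poly_Mapping.map (scaleC c)"

lemma lookup_scaleC [simp]:
  "Poly_Mapping.lookup (c *\<^sub>C p) k = c *\<^sub>C Poly_Mapping.lookup p k"
  for p :: "'a \<Rightarrow>\<^sub>0 'b"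
  by (simp add: scaleC_poly_mapping_def map.rep_eq when_def)

instance
  by standard
    (auto intro!: poly_mapping_eqI
      simp: lookup_add scaleC_add_right scaleC_add_left scaleC_scaleC scaleC_one)
end

abbreviation (input) delta :: "'a \<Rightarrow> ('a \<Rightarrow>\<^sub>0 complex)"
  where "delta k \<equiv> Poly_Mapping.single k 1"

definition bilinear_relators :: "('a::complex_vector \<times> 'b::complex_vector \<Rightarrow>\<^sub>0 complex) set"
  where "bilinear_relators =
      {delta (x + x', y) - delta (x, y) - delta (x', y) | x x' y. True}
    \<union> {delta (x, y + y') - delta (x, y) - delta (x, y') | x y y'. True}
    \<union> {delta (c *\<^sub>C x, y) - c *\<^sub>C delta (x, y) | c x y. True}
    \<union> {delta (x, c *\<^sub>C y) - c *\<^sub>C delta (x, y) | c x y. True}"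

definition tensor_eq ::
    "('a::complex_vector \<times> 'b::complex_vector \<Rightarrow>\<^sub>0 complex) \<Rightarrow> ('a \<times> 'b \<Rightarrow>\<^sub>0 complex) \<Rightarrow> bool"
  where "tensor_eq p q \<longleftrightarrow> p - q \<in> complex_vector.span bilinear_relators"

lemma equivp_tensor_eq:
  "equivp (tensor_eq :: ('a::complex_vector \<times> 'b::complex_vector \<Rightarrow>\<^sub>0 complex) \<Rightarrow> _)"
  (is "equivp ?r")
proof (rule equivpI)
  show "reflp ?r"
    by (simp add: reflp_def tensor_eq_def complex_vector.span_zero)
  show "symp ?r"
    unfolding symp_def tensor_eq_def by (metis complex_vector.span_neg minus_diff_eq)
  show "transp ?r"
  proof (rule transpI)
    fix p q r :: "'a \<times> 'b \<Rightarrow>\<^sub>0 complex"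
    assume "tensor_eq p q" "tensor_eq q r"
    then have "(p - q) + (q - r) \<in> complex_vector.span bilinear_relators"
      unfolding tensor_eq_def by (rule complex_vector.span_add)
    then show "tensor_eq p r" by (simp add: tensor_eq_def)
  qed
qed

quotient_type (overloaded) ('a, 'b) tensor =
  "'a::complex_vector \<times> 'b::complex_vector \<Rightarrow>\<^sub>0 complex" / tensor_eq
  by (rule equivp_tensor_eq)

instantiation tensor :: (complex_vector, complex_vector) complex_vector
begin

lift_definition zero_tensor :: "('a, 'b) tensor" is 0 .

lift_definition plus_tensor :: "('a, 'b) tensor \<Rightarrow> ('a, 'b) tensor \<Rightarrow> ('a, 'b) tensor" is "(+)"
  unfolding tensor_eq_def by (metis add_diff_add complex_vector.span_add)

lift_definition minus_tensor :: "('a, 'b) tensor \<Rightarrow> ('a, 'b) tensor \<Rightarrow> ('a, 'b) tensor" is "(-)"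
  unfolding tensor_eq_def
proof -
  fix p p' q q' :: "'a \<times> 'b \<Rightarrow>\<^sub>0 complex"
  assume "p - p' \<in> complex_vector.span bilinear_relators"
    and "q - q' \<in> complex_vector.span bilinear_relators"
  then have "(p - p') - (q - q') \<in> complex_vector.span bilinear_relators"
    by (rule complex_vector.span_diff)
  then show "(p - q) - (p' - q') \<in> complex_vector.span bilinear_relators"
    by (simp add: algebra_simps)
qed

lift_definition uminus_tensor :: "('a, 'b) tensor \<Rightarrow> ('a, 'b) tensor" is uminus
  unfolding tensor_eq_def by (metis complex_vector.span_neg minus_diff_minus)

lift_definition scaleC_tensor :: "complex \<Rightarrow> ('a, 'b) tensor \<Rightarrow> ('a, 'b) tensor" is scaleC
  unfolding tensor_eq_def by (metis complex_vector.span_scale complex_vector.scale_right_diff_distrib)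

lemma tensor_eq_refl: "tensor_eq p p"
  by (simp add: tensor_eq_def complex_vector.span_zero)

instance
proof
  fix a b c :: "('a, 'b) tensor" and r s :: complex
  show "a + b + c = a + (b + c)" by transfer (simp add: tensor_eq_refl add.assoc)
  show "a + b = b + a" by transfer (simp add: tensor_eq_refl add.commute)
  show "0 + a = a" by transfer (simp add: tensor_eq_refl)
  show "- a + a = 0" by transfer (simp add: tensor_eq_refl)
  show "a - b = a + - b" by transfer (simp add: tensor_eq_refl)
  show "r *\<^sub>C (a + b) = r *\<^sub>C a + r *\<^sub>C b"
    by transfer (simp add: tensor_eq_refl scaleC_add_right)
  show "(r + s) *\<^sub>C a = r *\<^sub>C a + s *\<^sub>C a"
    by transfer (simp add: tensor_eq_refl scaleC_add_left)
  show "r *\<^sub>C s *\<^sub>C a = (r * s) *\<^sub>C a"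
    by transfer (simp add: tensor_eq_refl scaleC_scaleC)
  show "1 *\<^sub>C a = a" by transfer (simp add: tensor_eq_refl scaleC_one)
qed

end

lift_definition tensor_elem ::
    "'a::complex_vector \<Rightarrow> 'b::complex_vector \<Rightarrow> ('a, 'b) tensor" (infixr "\<otimes>" 76)
  is "\<lambda>x y. delta (x, y)" .

lemma clinearI:
  assumes "\<And>x y. f (x + y) = f x + f y" "\<And>c x. f (c *\<^sub>C x) = c *\<^sub>C f x"
  shows "clinear f"
  using assms by unfold_locales auto

lemma clinear_add: "clinear f \<Longrightarrow> f (x + y) = f x + f y"
  by (simp add: Vector_Spaces.linear_def module_hom_def module_hom_axioms_def)

lemma clinear_scaleC: "clinear f \<Longrightarrow> f (c *\<^sub>C x) = c *\<^sub>C f x"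
  by (simp add: Vector_Spaces.linear_def module_hom_def module_hom_axioms_def)

lemma cbilinearD:
  assumes "cbilinear f"
  shows "f (x + x') y = f x y + f x' y" "f x (y + y') = f x y + f x y'"
    "f (c *\<^sub>C x) y = c *\<^sub>C f x y" "f x (c *\<^sub>C y) = c *\<^sub>C f x y"
  using assms clinear_add[of "\<lambda>x. f x y"] clinear_add[of "f x"]
    clinear_scaleC[of "\<lambda>x. f x y"] clinear_scaleC[of "f x"]
  by (simp_all add: cbilinear_def)

lemma cbilinearI:
  assumes "\<And>x x' y. f (x + x') y = f x y + f x' y" "\<And>x y y'. f x (y + y') = f x y + f x y'"
    "\<And>c x y. f (c *\<^sub>C x) y = c *\<^sub>C f x y" "\<And>c x y. f x (c *\<^sub>C y) = c *\<^sub>C f x y"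
  shows "cbilinear f"
  using assms by (auto simp: cbilinear_def intro!: clinearI)

lemma cbilinear_tensor_elem: "cbilinear (\<otimes>)"
proof -
  have *: "tensor_eq p q" if "p - q \<in> bilinear_relators"
    for p q :: "'a \<times> 'b \<Rightarrow>\<^sub>0 complex"
    using that by (simp add: tensor_eq_def complex_vector.span_base)
  have "(x + x') \<otimes> y = x \<otimes> y + x' \<otimes> y" for x x' :: 'a and y :: 'b
    by transfer (rule *, force simp: bilinear_relators_def diff_diff_add)
  moreover have "x \<otimes> (y + y') = x \<otimes> y + x \<otimes> y'" for x :: 'a and y y' :: 'b
    by transfer (rule *, force simp: bilinear_relators_def diff_diff_add)
  moreover have "(c *\<^sub>C x) \<otimes> y = c *\<^sub>C (x \<otimes> y)" for c and x :: 'a and y :: 'b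
    by transfer (rule *, force simp: bilinear_relators_def)
  moreover have "x \<otimes> (c *\<^sub>C y) = c *\<^sub>C (x \<otimes> y)" for c and x :: 'a and y :: 'b
    by transfer (rule *, force simp: bilinear_relators_def)
  ultimately show ?thesis
    by (auto simp: cbilinear_def intro!: clinearI)
qed

text \<open>The linear map induced by a bilinear one; it is well defined by the universal property
  proved in \<open>tensor_lift_unique_existence\<close>.\<close>

definition tensor_lift ::
    "('a::complex_vector \<Rightarrow> 'b::complex_vector \<Rightarrow> 'c::complex_vector) \<Rightarrow> ('a, 'b) tensor \<Rightarrow> 'c"
  where "tensor_lift f = (THE g. clinear g \<and> (\<forall>x y. g (x \<otimes> y) = f x y))"

definition free_extend :: "('a \<Rightarrow> 'c::complex_vector) \<Rightarrow> ('a \<Rightarrow>\<^sub>0 complex) \<Rightarrow> 'c"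
  where "free_extend f p = (\<Sum>k\<in>Poly_Mapping.keys p. Poly_Mapping.lookup p k *\<^sub>C f k)"

lemma free_extend_superset:
  assumes "finite S" "Poly_Mapping.keys p \<subseteq> S"
  shows "free_extend f p = (\<Sum>k\<in>S. Poly_Mapping.lookup p k *\<^sub>C f k)"
  unfolding free_extend_def
  by (rule sum.mono_neutral_left) (use assms in \<open>auto simp: in_keys_iff\<close>)

lemma clinear_free_extend: "clinear (free_extend f)"
proof (rule clinearI)
  fix p q :: "'a \<Rightarrow>\<^sub>0 complex" and c :: complex
  let ?S = "Poly_Mapping.keys p \<union> Poly_Mapping.keys q"
  have "free_extend f (p + q) = (\<Sum>k\<in>?S. Poly_Mapping.lookup (p + q) k *\<^sub>C f k)"
    by (rule free_extend_superset) (simp_all add: Poly_Mapping.keys_add)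
  also have "\<dots> = free_extend f p + free_extend f q"
    by (simp add: free_extend_superset[of ?S] lookup_add scaleC_add_left sum.distrib)
  finally show "free_extend f (p + q) = free_extend f p + free_extend f q" .
  have "Poly_Mapping.keys (c *\<^sub>C p) \<subseteq> Poly_Mapping.keys p"
    by (auto simp: in_keys_iff scaleC_complex_def)
  then show "free_extend f (c *\<^sub>C p) = c *\<^sub>C free_extend f p"
    by (simp add: free_extend_superset[of "Poly_Mapping.keys p"] scaleC_complex_def
        complex_vector.scale_sum_right scaleC_scaleC)
qed

lemma free_extend_delta [simp]: "free_extend f (delta k) = f k"
  by (simp add: free_extend_def scaleC_one)

lemma tensor_induct [case_names add scale elem]:
  assumes add: "\<And>t u. P t \<Longrightarrow> P u \<Longrightarrow> P (t + u)"
    and scale: "\<And>c t. P t \<Longrightarrow> P (c *\<^sub>C t)"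
    and elem: "\<And>x y. P (x \<otimes> y)"
  shows "P t"
proof -
  have 0: "P 0" using scale[of "0 \<otimes> 0" 0] elem by simp
  have "P (abs_tensor p)" for p
  proof (induction p rule: update_induct)
    case const
    then show ?case using 0 by (simp add: zero_tensor_def)
  next
    case (update p k b)
    have "Poly_Mapping.update k b p = p + b *\<^sub>C delta k"
      using update(1)
      by (auto intro!: poly_mapping_eqI
          simp: lookup_update lookup_add lookup_single scaleC_complex_def in_keys_iff)
    then have "abs_tensor (Poly_Mapping.update k b p)
        = abs_tensor p + b *\<^sub>C (fst k \<otimes> snd k)"
      by (simp add: plus_tensor.abs_eq scaleC_tensor.abs_eq tensor_elem.abs_eq)
    then show ?case using update(3) add scale elem by simp
  qed
  then show ?thesis by (metis Quotient3_tensor Quotient3_abs_rep)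
qed

lemma tensor_lift_unique_existence:
  assumes f: "cbilinear f"
  shows "\<exists>!g. clinear g \<and> (\<forall>x y. g (x \<otimes> y) = f x y)"
proof (rule ex_ex1I)
  let ?e = "free_extend (\<lambda>(x, y). f x y)"
  have lin: "clinear ?e" by (rule clinear_free_extend)
  interpret e: Vector_Spaces.linear scaleC scaleC ?e by (rule lin)
  have rel: "?e p = 0" if "p \<in> bilinear_relators" for p
    using that
    by (auto simp: bilinear_relators_def e.diff e.scale cbilinearD[OF f])
  have "?e p = 0" if "p \<in> complex_vector.span bilinear_relators" for p
    using that rel e.eq_0_on_span by blast
  then have resp: "?e p = ?e q" if "tensor_eq p q" for p q
    using that by (metis tensor_eq_def e.diff right_minus_eq)
  define g where "g t = ?e (rep_tensor t)" for t
  have g: "g (abs_tensor p) = ?e p" for p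
    unfolding g_def by (rule resp) (metis Quotient3_tensor equivp_tensor_eq rep_abs_rsp_left tensor_eq_refl)
  have "clinear g"
  proof (rule clinearI)
    fix t u :: "('a, 'b) tensor" and c
    obtain p q where pq: "t = abs_tensor p" "u = abs_tensor q"
      by (metis Quotient3_tensor Quotient3_abs_rep)
    show "g (t + u) = g t + g u"
      by (simp add: pq g plus_tensor.abs_eq e.add)
    show "g (c *\<^sub>C t) = c *\<^sub>C g t"
      by (simp add: pq g scaleC_tensor.abs_eq e.scale)
  qed
  moreover have "g (x \<otimes> y) = f x y" for x y
    by (simp add: tensor_elem.abs_eq g)
  ultimately show "\<exists>g. clinear g \<and> (\<forall>x y. g (x \<otimes> y) = f x y)" by blast
next
  fix g h :: "('a, 'b) tensor \<Rightarrow> 'c"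
  assume g: "clinear g \<and> (\<forall>x y. g (x \<otimes> y) = f x y)"
    and h: "clinear h \<and> (\<forall>x y. h (x \<otimes> y) = f x y)"
  have "g t = h t" for t
    by (induction t rule: tensor_induct) (use g h in \<open>auto simp: clinear_add clinear_scaleC\<close>)
  then show "g = h" by blast
qed

lemma
  assumes "cbilinear f"
  shows clinear_tensor_lift: "clinear (tensor_lift f)"
    and tensor_lift_elem: "tensor_lift f (x \<otimes> y) = f x y"
  using theI'[OF tensor_lift_unique_existence[OF assms]] by (simp_all add: tensor_lift_def)


section \<open>The Hilbert tensor square and the operation \<open>\<diamondsuit>\<close>\<close>

text \<open>\<open>(K, j)\<close> is a Hilbert tensor product of \<open>H\<close> with itself: the completion of the
  algebraic tensor product in the inner product
  \<open>\<langle>\<xi> \<otimes> \<eta>, \<xi>' \<otimes> \<eta>'\<rangle> = \<langle>\<xi>, \<xi>'\<rangle> \<langle>\<eta>, \<eta>'\<rangle>\<close>, where \<open>K\<close> is the whole type \<open>'k\<close>.\<close>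

definition hilbert_tensor_square :: "(('h::chilbert_space, 'h) tensor \<Rightarrow> 'k::chilbert_space) \<Rightarrow> bool"
  where "hilbert_tensor_square j \<longleftrightarrow> clinear j
    \<and> (\<forall>\<xi> \<eta> \<xi>' \<eta>'. cinner (j (\<xi> \<otimes> \<eta>)) (j (\<xi>' \<otimes> \<eta>')) = cinner \<xi> \<xi>' * cinner \<eta> \<eta>')
    \<and> closure (range j) = UNIV"

definition diamond ::
    "(('h::chilbert_space, 'h) tensor \<Rightarrow> 'k::chilbert_space) \<Rightarrow> ('k \<Rightarrow> 'h) \<Rightarrow> 'h \<Rightarrow> 'h \<Rightarrow> 'h"
  where "diamond j \<iota> \<xi> \<eta> = \<iota> (j (\<xi> \<otimes> \<eta>))"


section \<open>Amplifications and \<open>PL\<close>-spaces\<close>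

definition op_act :: "('h::chilbert_space \<Rightarrow> 'h) \<Rightarrow> ('h, 'e::complex_vector) tensor \<Rightarrow> ('h, 'e) tensor"
    (infixr "\<cdot>" 74)
  where "a \<cdot> u = tensor_lift (\<lambda>\<xi> x. a \<xi> \<otimes> x) u"

definition amp :: "('e::complex_vector \<Rightarrow> 'f::complex_vector)
    \<Rightarrow> ('h::chilbert_space, 'e) tensor \<Rightarrow> ('h, 'f) tensor"
  where "amp \<phi> u = tensor_lift (\<lambda>\<xi> x. \<xi> \<otimes> \<phi> x) u"

text \<open>In the following, \<open>d\<close> stands for the operation \<open>\<diamondsuit>\<close> on \<open>H\<close>.\<close>

definition bilinear_amp :: "('h::chilbert_space \<Rightarrow> 'h \<Rightarrow> 'h)
    \<Rightarrow> ('e::complex_vector \<Rightarrow> 'f::complex_vector \<Rightarrow> 'g::complex_vector)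
    \<Rightarrow> ('h, 'e) tensor \<Rightarrow> ('h, 'f) tensor \<Rightarrow> ('h, 'g) tensor"
  where "bilinear_amp d R u v =
    tensor_lift (\<lambda>\<xi> x. tensor_lift (\<lambda>\<eta> y. d \<xi> \<eta> \<otimes> R x y) v) u"

definition tensor_diamond :: "('h::chilbert_space \<Rightarrow> 'h \<Rightarrow> 'h)
    \<Rightarrow> ('h, 'e::complex_vector) tensor \<Rightarrow> ('h, 'f::complex_vector) tensor
    \<Rightarrow> ('h, ('e, 'f) tensor) tensor"
  where "tensor_diamond d u v =
    tensor_lift (\<lambda>\<xi> x. tensor_lift (\<lambda>\<eta> y. d \<xi> \<eta> \<otimes> (x \<otimes> y)) v) u"

lemmas clin_simps = clinear_add clinear_scaleC

lemma op_act:
  assumes "clinear a"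
  shows "clinear ((\<cdot>) a)" "a \<cdot> (\<xi> \<otimes> x) = a \<xi> \<otimes> x"
proof -
  have "cbilinear (\<lambda>\<xi> x. a \<xi> \<otimes> x)"
    using assms by (auto intro!: cbilinearI simp: clin_simps cbilinearD[OF cbilinear_tensor_elem])
  then show "clinear ((\<cdot>) a)" "a \<cdot> (\<xi> \<otimes> x) = a \<xi> \<otimes> x"
    using clinear_tensor_lift tensor_lift_elem by (auto simp: op_act_def[abs_def])
qed

lemma amp:
  assumes "clinear \<phi>"
  shows "clinear (amp \<phi>)" "amp \<phi> (\<xi> \<otimes> x) = \<xi> \<otimes> \<phi> x"
proof -
  have "cbilinear (\<lambda>\<xi> x. \<xi> \<otimes> \<phi> x)"
    using assms by (auto intro!: cbilinearI simp: clin_simps cbilinearD[OF cbilinear_tensor_elem])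
  then show "clinear (amp \<phi>)" "amp \<phi> (\<xi> \<otimes> x) = \<xi> \<otimes> \<phi> x"
    using clinear_tensor_lift tensor_lift_elem by (auto simp: amp_def[abs_def])
qed

lemma bilinear_amp:
  assumes d: "cbilinear d" and R: "cbilinear R"
  shows "cbilinear (bilinear_amp d R)"
    and "bilinear_amp d R (\<xi> \<otimes> x) (\<eta> \<otimes> y) = d \<xi> \<eta> \<otimes> R x y"
proof -
  define L where "L \<xi> x v = tensor_lift (\<lambda>\<eta> y. d \<xi> \<eta> \<otimes> R x y) v" for \<xi> x v
  have inner: "cbilinear (\<lambda>\<eta> y. d \<xi> \<eta> \<otimes> R x y)" for \<xi> x
    by (intro cbilinearI) (simp_all add: cbilinearD[OF d] cbilinearD[OF R] cbilinearD[OF cbilinear_tensor_elem])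
  have L: "clinear (L \<xi> x)" "L \<xi> x (\<eta> \<otimes> y) = d \<xi> \<eta> \<otimes> R x y" for \<xi> x \<eta> y
    using clinear_tensor_lift[OF inner] tensor_lift_elem[OF inner] by (simp_all add: L_def[abs_def])
  have outer: "cbilinear (\<lambda>\<xi> x. L \<xi> x v)" for v
  proof (rule cbilinearI)
    show "L (\<xi> + \<xi>') x v = L \<xi> x v + L \<xi>' x v" for \<xi> \<xi>' x
      by (induction v rule: tensor_induct)
        (simp_all add: L clin_simps[OF L(1)] cbilinearD[OF d] cbilinearD[OF cbilinear_tensor_elem]
          scaleC_add_right add_ac)
    show "L \<xi> (x + x') v = L \<xi> x v + L \<xi> x' v" for \<xi> x x'
      by (induction v rule: tensor_induct)
        (simp_all add: L clin_simps[OF L(1)] cbilinearD[OF R] cbilinearD[OF cbilinear_tensor_elem]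
          scaleC_add_right add_ac)
    show "L (c *\<^sub>C \<xi>) x v = c *\<^sub>C L \<xi> x v" for c \<xi> x
      by (induction v rule: tensor_induct)
        (simp_all add: L clin_simps[OF L(1)] cbilinearD[OF d] cbilinearD[OF cbilinear_tensor_elem]
          scaleC_add_right add_ac scaleC_scaleC mult.commute)
    show "L \<xi> (c *\<^sub>C x) v = c *\<^sub>C L \<xi> x v" for c \<xi> x
      by (induction v rule: tensor_induct)
        (simp_all add: L clin_simps[OF L(1)] cbilinearD[OF R] cbilinearD[OF cbilinear_tensor_elem]
          scaleC_add_right add_ac scaleC_scaleC mult.commute)
  qed
  define M where "M v u = tensor_lift (\<lambda>\<xi> x. L \<xi> x v) u" for v u
  have O: "clinear (M v)" "M v (\<xi> \<otimes> x) = L \<xi> x v" for v \<xi> x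
    using clinear_tensor_lift[OF outer] tensor_lift_elem[OF outer] by (simp_all add: M_def[abs_def])
  have eq: "bilinear_amp d R u v = M v u" for u v
    by (simp add: bilinear_amp_def M_def L_def)
  show "bilinear_amp d R (\<xi> \<otimes> x) (\<eta> \<otimes> y) = d \<xi> \<eta> \<otimes> R x y"
    by (simp add: eq O L)
  show "cbilinear (bilinear_amp d R)"
  proof (rule cbilinearI)
    fix u u' :: "('a, 'b) tensor" and v v' :: "('a, 'c) tensor" and c
    show "bilinear_amp d R (u + u') v = bilinear_amp d R u v + bilinear_amp d R u' v"
      "bilinear_amp d R (c *\<^sub>C u) v = c *\<^sub>C bilinear_amp d R u v"
      by (simp_all add: eq clin_simps[OF O(1)])
    show "bilinear_amp d R u (v + v') = bilinear_amp d R u v + bilinear_amp d R u v'"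
      unfolding eq
      by (induction u rule: tensor_induct)
        (simp_all add: O clin_simps[OF O(1)] clin_simps[OF L(1)] scaleC_add_right add_ac)
    show "bilinear_amp d R u (c *\<^sub>C v) = c *\<^sub>C bilinear_amp d R u v"
      unfolding eq
      by (induction u rule: tensor_induct)
        (simp_all add: O clin_simps[OF O(1)] clin_simps[OF L(1)] scaleC_add_right add_ac
          scaleC_scaleC mult.commute)
  qed
qed

lemma tensor_diamond_eq: "tensor_diamond d = bilinear_amp d (\<otimes>)"
  by (intro ext) (simp add: tensor_diamond_def bilinear_amp_def)

text \<open>A (semi-)normed \<open>PL\<close>-space \<open>E\<close> is the type \<open>'e\<close> together with a function \<open>N\<close>
  on \<open>HE\<close> such that the following holds.\<close>

definition PL_seminorm :: "(('h::chilbert_space, 'e::complex_vector) tensor \<Rightarrow> real) \<Rightarrow> bool"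
  where "PL_seminorm N \<longleftrightarrow>
      (\<forall>u. 0 \<le> N u)
    \<and> (\<forall>c u. N (c *\<^sub>C u) = cmod c * N u)
    \<and> (\<forall>u v. N (u + v) \<le> N u + N v)
    \<and> (\<forall>a u. bounded_clinear a \<longrightarrow> N (a \<cdot> u) \<le> onorm a * N u)"

definition PL_norm :: "(('h::chilbert_space, 'e::complex_vector) tensor \<Rightarrow> real) \<Rightarrow> bool"
  where "PL_norm N \<longleftrightarrow> PL_seminorm N \<and> (\<forall>u. N u = 0 \<longrightarrow> u = 0)"

definition L_bounded :: "(('h::chilbert_space, 'e::complex_vector) tensor \<Rightarrow> real)
    \<Rightarrow> (('h, 'f::complex_vector) tensor \<Rightarrow> real) \<Rightarrow> ('e \<Rightarrow> 'f) \<Rightarrow> bool"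
  where "L_bounded NE NF \<phi> \<longleftrightarrow> clinear \<phi> \<and> (\<exists>C. \<forall>u. NF (amp \<phi> u) \<le> C * NE u)"

definition lb_norm :: "(('h::chilbert_space, 'e::complex_vector) tensor \<Rightarrow> real)
    \<Rightarrow> (('h, 'f::complex_vector) tensor \<Rightarrow> real) \<Rightarrow> ('e \<Rightarrow> 'f) \<Rightarrow> real"
  where "lb_norm NE NF \<phi> = Sup {NF (amp \<phi> u) | u. NE u \<le> 1}"

definition L_bounded_bilinear :: "('h::chilbert_space \<Rightarrow> 'h \<Rightarrow> 'h)
    \<Rightarrow> (('h, 'e::complex_vector) tensor \<Rightarrow> real) \<Rightarrow> (('h, 'f::complex_vector) tensor \<Rightarrow> real)
    \<Rightarrow> (('h, 'g::complex_vector) tensor \<Rightarrow> real) \<Rightarrow> ('e \<Rightarrow> 'f \<Rightarrow> 'g) \<Rightarrow> bool"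
  where "L_bounded_bilinear d NE NF NG R \<longleftrightarrow> cbilinear R
    \<and> (\<exists>C. \<forall>u v. NG (bilinear_amp d R u v) \<le> C * NE u * NF v)"

definition L_contractive_bilinear :: "('h::chilbert_space \<Rightarrow> 'h \<Rightarrow> 'h)
    \<Rightarrow> (('h, 'e::complex_vector) tensor \<Rightarrow> real) \<Rightarrow> (('h, 'f::complex_vector) tensor \<Rightarrow> real)
    \<Rightarrow> (('h, 'g::complex_vector) tensor \<Rightarrow> real) \<Rightarrow> ('e \<Rightarrow> 'f \<Rightarrow> 'g) \<Rightarrow> bool"
  where "L_contractive_bilinear d NE NF NG R \<longleftrightarrow> cbilinear R
    \<and> (\<forall>u v. NG (bilinear_amp d R u v) \<le> NE u * NF v)"

definition lb_norm_bilinear :: "('h::chilbert_space \<Rightarrow> 'h \<Rightarrow> 'h)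
    \<Rightarrow> (('h, 'e::complex_vector) tensor \<Rightarrow> real) \<Rightarrow> (('h, 'f::complex_vector) tensor \<Rightarrow> real)
    \<Rightarrow> (('h, 'g::complex_vector) tensor \<Rightarrow> real) \<Rightarrow> ('e \<Rightarrow> 'f \<Rightarrow> 'g) \<Rightarrow> real"
  where "lb_norm_bilinear d NE NF NG R =
    Sup {NG (bilinear_amp d R u v) | u v. NE u \<le> 1 \<and> NF v \<le> 1}"


section \<open>The \<open>PL\<close>-tensor product\<close>

definition pl_norm :: "('h::chilbert_space \<Rightarrow> 'h \<Rightarrow> 'h)
    \<Rightarrow> (('h, 'e::complex_vector) tensor \<Rightarrow> real) \<Rightarrow> (('h, 'f::complex_vector) tensor \<Rightarrow> real)
    \<Rightarrow> ('h, ('e, 'f) tensor) tensor \<Rightarrow> real"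
  where "pl_norm d NE NF U =
    Inf {(\<Sum>k<n. onorm (a k) * NE (u k) * NF (v k)) | (n::nat) a u v.
      (\<forall>k<n. bounded_clinear (a k)) \<and> U = (\<Sum>k<n. a k \<cdot> tensor_diamond d (u k) (v k))}"

end

theory Submission
  imports Defs
begin

text \<open>Only the definiteness of \<open>pl_norm\<close> needs more than bookkeeping. A bounded functional \<open>f\<close> on
  \<open>E\<close> (normed by \<open>x \<mapsto> NE (e \<otimes> x)\<close> for a unit vector \<open>e\<close>) is automatically \<open>L\<close>-bounded: composing
  with the rank one operator \<open>z \<mapsto> \<langle>z, w\<rangle> e\<close> reduces the estimate of \<open>f\<^sub>\<infinity> u \<in> H\<close> to one of \<open>f\<close> on
  elements of \<open>e \<otimes> E\<close>. Hence \<open>(f \<otimes> g)\<^sub>\<infinity>\<close> is dominated by \<open>pl_norm\<close> for all bounded functionals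
  \<open>f\<close>, \<open>g\<close>, and by Hahn-Banach these maps separate the points of \<open>H (E \<otimes> F)\<close>.\<close>

section \<open>Separation by functionals dominated by a seminorm\<close>

text \<open>Positive homogeneity as an equation follows from the stated inequality, see
  \<open>sublinear_scale\<close>.\<close>

definition sublinear :: "('a::complex_vector \<Rightarrow> real) \<Rightarrow> bool"
  where "sublinear p \<longleftrightarrow> (\<forall>x y. p (x + y) \<le> p x + p y)
    \<and> (\<forall>r x. 0 < r \<longrightarrow> p (complex_of_real r *\<^sub>C x) \<le> r * p x)"

lemma sublinear_add: "sublinear p \<Longrightarrow> p (x + y) \<le> p x + p y"
  by (simp add: sublinear_def)

lemma sublinear_zero:
  assumes "sublinear p"
  shows "p 0 = 0"
proof -
  have "p 0 \<le> p 0 + p 0" using sublinear_add[OF assms, of 0 0] by simp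
  moreover have "p 0 \<le> (1/2) * p 0"
    using assms[unfolded sublinear_def, THEN conjunct2, rule_format, of "1/2" 0] by simp
  ultimately show ?thesis by linarith
qed

lemma sublinear_scale:
  assumes p: "sublinear p" and r: "0 \<le> r"
  shows "p (complex_of_real r *\<^sub>C x) = r * p x"
proof (cases "r = 0")
  case True
  then show ?thesis using sublinear_zero[OF p] by simp
next
  case False
  then have r: "0 < r" using r by simp
  have le: "p (complex_of_real s *\<^sub>C y) \<le> s * p y" if "0 < s" for s y
    using p that by (simp add: sublinear_def)
  have "p x = p (complex_of_real (inverse r) *\<^sub>C complex_of_real r *\<^sub>C x)"
    using r by (simp add: scaleC_scaleC scaleC_one flip: of_real_mult)
  also have "\<dots> \<le> inverse r * p (complex_of_real r *\<^sub>C x)"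
    using r by (intro le) simp
  finally have "r * p x \<le> p (complex_of_real r *\<^sub>C x)"
    using r by (simp add: field_simps)
  then show ?thesis using le[OF r, of x] by simp
qed

lemma sublinear_minus:
  assumes "sublinear p"
  shows "- p (- x) \<le> p x"
  using sublinear_add[OF assms, of x "- x"] sublinear_zero[OF assms] by simp

text \<open>Since the index may change in both conditions, the lemma covers the half line of shifts
  in \<open>sublinear_shift\<close> as well as the chains in Zorn's lemma.\<close>

lemma sublinear_INF:
  assumes ne: "I \<noteq> {}"
    and bdd: "\<And>x. bdd_below ((\<lambda>i. q i x) ` I)"
    and add: "\<And>i j x y. i \<in> I \<Longrightarrow> j \<in> I \<Longrightarrow> \<exists>k\<in>I. q k (x + y) \<le> q i x + q j y"
    and scale: "\<And>i r x. i \<in> I \<Longrightarrow> 0 < r \<Longrightarrow> \<exists>k\<in>I. q k (complex_of_real r *\<^sub>C x) \<le> r * q i x"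
  shows "sublinear (\<lambda>x. INF i\<in>I. q i x)"
proof -
  define P where "P x = (INF i\<in>I. q i x)" for x
  have low: "P x \<le> q i x" if "i \<in> I" for i x
    unfolding P_def by (rule cINF_lower[OF bdd that])
  have great: "c \<le> P x" if "\<And>i. i \<in> I \<Longrightarrow> c \<le> q i x" for c x
    unfolding P_def using ne that by (rule cINF_greatest)
  have "P (x + y) \<le> P x + P y" for x y
  proof -
    \<comment> \<open>The infimum over the first index is taken with \<open>j\<close> fixed, the one
      over \<open>j\<close> afterwards.\<close>
    have "P (x + y) - q j y \<le> P x" if "j \<in> I" for j
    proof (rule great)
      fix i assume "i \<in> I"
      then obtain k where "k \<in> I" "q k (x + y) \<le> q i x + q j y" using add \<open>j \<in> I\<close> by blast
      then show "P (x + y) - q j y \<le> q i x" using low[of k "x + y"] by simp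
    qed
    then have "P (x + y) - P x \<le> P y" by (intro great) (simp add: algebra_simps)
    then show ?thesis by simp
  qed
  moreover have "P (complex_of_real r *\<^sub>C x) \<le> r * P x" if r: "0 < r" for r x
  proof -
    have "P (complex_of_real r *\<^sub>C x) / r \<le> P x"
    proof (rule great)
      fix i assume "i \<in> I"
      then obtain k where "k \<in> I" "q k (complex_of_real r *\<^sub>C x) \<le> r * q i x"
        using scale r by blast
      then show "P (complex_of_real r *\<^sub>C x) / r \<le> q i x"
        using low[of k "complex_of_real r *\<^sub>C x"] r by (simp add: field_simps)
    qed
    then show ?thesis using r by (simp add: field_simps)
  qed
  ultimately show ?thesis by (simp add: sublinear_def flip: P_def)
qed

text \<open>A minimal sublinear function admits no proper such \<open>q\<close>, which forces it to be odd and hence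
  linear.\<close>

lemma sublinear_shift:
  assumes p: "sublinear p"
  obtains q where "sublinear q" "q \<le> p" "q (- y) \<le> - p y"
proof
  \<comment> \<open>The candidate is the infimum of \<open>Q t\<close> over
    \<open>t \<ge> 0\<close>: \<open>t = 0\<close> puts it below \<open>p\<close>, and
    \<open>t = 1\<close> gives the bound at \<open>- y\<close>.\<close>
  define Q where "Q t x = p (x + complex_of_real t *\<^sub>C y) - t * p y" for t x
  define q where "q x = (INF t\<in>{0..}. Q t x)" for x
  have bdd: "bdd_below ((\<lambda>t. Q t x) ` {0..})" for x
  proof (rule bdd_belowI2)
    fix t :: real assume "t \<in> {0..}"
    then have "t * p y = p (complex_of_real t *\<^sub>C y)" by (simp add: sublinear_scale[OF p])
    also have "\<dots> \<le> p (x + complex_of_real t *\<^sub>C y) + p (- x)"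
      using sublinear_add[OF p, of "x + complex_of_real t *\<^sub>C y" "- x"] by simp
    finally show "- p (- x) \<le> Q t x" by (simp add: Q_def)
  qed
  have low: "q x \<le> Q t x" if "0 \<le> t" for t x
    unfolding q_def using that by (intro cINF_lower[OF bdd]) simp
  show "sublinear q"
    unfolding q_def
  proof (rule sublinear_INF[OF _ bdd])
    fix s t :: real and x x' assume st: "s \<in> {0..}" "t \<in> {0..}"
    have "Q (s + t) (x + x') \<le> Q s x + Q t x'"
      using sublinear_add[OF p, of "x + complex_of_real s *\<^sub>C y" "x' + complex_of_real t *\<^sub>C y"]
      by (simp add: Q_def scaleC_add_left algebra_simps)
    then show "\<exists>k\<in>{0..}. Q k (x + x') \<le> Q s x + Q t x'"
      using st by (intro bexI[of _ "s + t"]) auto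
  next
    fix t r :: real and x assume t: "t \<in> {0..}" and r: "0 < r"
    have "complex_of_real r *\<^sub>C (x + complex_of_real t *\<^sub>C y)
        = complex_of_real r *\<^sub>C x + complex_of_real (r * t) *\<^sub>C y"
      by (simp add: scaleC_add_right scaleC_scaleC)
    then have "Q (r * t) (complex_of_real r *\<^sub>C x) = r * Q t x"
      using sublinear_scale[OF p, of r "x + complex_of_real t *\<^sub>C y"] r
      by (simp add: Q_def algebra_simps)
    then show "\<exists>k\<in>{0..}. Q k (complex_of_real r *\<^sub>C x) \<le> r * Q t x"
      using t r by (intro bexI[of _ "r * t"]) auto
  qed simp
  show "q \<le> p"
    using low[of 0] by (simp add: le_fun_def Q_def)
  show "q (- y) \<le> - p y"
    using low[of 1 "- y"] by (simp add: Q_def scaleC_one sublinear_zero[OF p])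
qed

text \<open>Zorn's lemma for the reversed pointwise order: a nonempty chain is bounded by its
  pointwise infimum, which is finite because every member satisfies
  \<open>q x \<ge> - p (- x)\<close>.\<close>

lemma minimal_sublinear_exists:
  assumes p: "sublinear p"
  obtains m where "sublinear m" "m \<le> p" "\<And>q. sublinear q \<Longrightarrow> q \<le> m \<Longrightarrow> q = m"
proof -
  let ?A = "{q. sublinear q \<and> q \<le> p}" and ?P = "\<lambda>q q'. q' \<le> q"
  have "\<exists>m\<in>?A. \<forall>q\<in>?A. ?P m q \<longrightarrow> q = m"
  proof (rule predicate_Zorn)
    show "partial_order_on ?A (relation_of ?P ?A)"
      by (rule partial_order_on_relation_ofI) auto
  next
    fix C assume C: "C \<in> Chains (relation_of ?P ?A)"
    then have A: "sublinear q" "q \<le> p" if "q \<in> C" for q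
      using that by (auto simp: Chains_def relation_of_def)
    have tot: "q \<le> q' \<or> q' \<le> q" if "q \<in> C" "q' \<in> C" for q q'
      using C that by (auto simp: Chains_def relation_of_def)
    show "\<exists>l\<in>?A. \<forall>q\<in>C. ?P q l"
    proof (cases "C = {}")
      case True
      then show ?thesis using p by auto
    next
      case ne: False
      have bdd: "bdd_below ((\<lambda>q. q x) ` C)" for x
      proof (rule bdd_belowI2)
        fix q assume "q \<in> C"
        then show "- p (- x) \<le> q x"
          using sublinear_minus[OF A(1), of q x] le_funD[OF A(2), of q "- x"] by simp
      qed
      let ?l = "\<lambda>x. INF q\<in>C. q x"
      have low: "?l \<le> q" if "q \<in> C" for q
        using that by (auto simp: le_fun_def intro!: cINF_lower[OF bdd])
      have "sublinear ?l"
      proof (rule sublinear_INF[OF ne bdd])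
        fix q q' and x y :: 'a assume q: "q \<in> C" "q' \<in> C"
        then show "\<exists>k\<in>C. k (x + y) \<le> q x + q' y"
          using tot[OF q] sublinear_add[OF A(1), of q x y] sublinear_add[OF A(1), of q' x y]
          by (smt (verit) le_funD)
      next
        fix q and r :: real and x assume "q \<in> C" "0 < r"
        then show "\<exists>k\<in>C. k (complex_of_real r *\<^sub>C x) \<le> r * q x"
          using sublinear_scale[OF A(1), of q r x] by (intro bexI[of _ q]) simp_all
      qed
      moreover have "?l \<le> p" using ne low A(2) order_trans by blast
      ultimately show ?thesis using low by auto
    qed
  qed
  then show ?thesis using that order_trans by blast
qed

lemma minimal_sublinear_linear:
  assumes m: "sublinear m" and min: "\<And>q. sublinear q \<Longrightarrow> q \<le> m \<Longrightarrow> q = m"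
  shows "m (x + y) = m x + m y" "m (complex_of_real r *\<^sub>C x) = r * m x"
proof -
  \<comment> \<open>Minimality identifies \<open>m\<close> with its shift at \<open>z\<close>, so
    \<open>m (- z) \<le> - m z\<close>; the other inequality holds for every sublinear
    function.\<close>
  have neg: "m (- z) = - m z" for z
  proof -
    obtain q where "sublinear q" "q \<le> m" "q (- z) \<le> - m z"
      using sublinear_shift[OF m] by blast
    then show ?thesis
      using min[of q] sublinear_minus[OF m, of z] by simp
  qed
  \<comment> \<open>Superadditivity is subadditivity for \<open>x = (x + y) + (- y)\<close> combined
    with oddness.\<close>
  show "m (x + y) = m x + m y"
    using sublinear_add[OF m, of x y] sublinear_add[OF m, of "x + y" "- y"] by (simp add: neg)
  show "m (complex_of_real r *\<^sub>C x) = r * m x"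
  proof (cases "0 \<le> r")
    case False
    then have "m (- (complex_of_real r *\<^sub>C x)) = - r * m x"
      using sublinear_scale[OF m, of "- r" x] by simp
    then show ?thesis by (simp add: neg)
  qed (simp add: sublinear_scale[OF m])
qed

text \<open>Shifting at \<open>x0\<close> before minimising brings the value at \<open>- x0\<close>
  down to at most \<open>- p x0\<close>, so a linear function below the shift attains
  \<open>p x0\<close>. This replaces the extension from a subspace.\<close>

lemma Hahn_Banach_real:
  assumes p: "sublinear p"
  obtains f where "\<And>x y. f (x + y) = f x + f y"
    "\<And>r x. f (complex_of_real r *\<^sub>C x) = r * f x"
    "\<And>x. f x \<le> p x" "f x0 = p x0"
proof -
  obtain q where q: "sublinear q" "q \<le> p" "q (- x0) \<le> - p x0"
    using sublinear_shift[OF p] by blast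
  obtain m where m: "sublinear m" "m \<le> q" "\<And>q'. sublinear q' \<Longrightarrow> q' \<le> m \<Longrightarrow> q' = m"
    using minimal_sublinear_exists[OF q(1)] by blast
  note lin = minimal_sublinear_linear[OF m(1,3)]
  have le: "m x \<le> p x" for x using m(2) q(2) by (meson le_funD order_trans)
  have "m (- x0) \<le> - p x0" using q(3) le_funD[OF m(2), of "- x0"] by linarith
  moreover have "m (- x0) = - m x0" using lin(2)[of "-1" x0] by (simp add: scaleC_one)
  ultimately have "m x0 = p x0" using le[of x0] by simp
  then show ?thesis using that lin le by blast
qed

text \<open>The complexification \<open>F x = f x - \<i> f (\<i> x)\<close> of a real functional is
  complex linear. The factor 2 comes from bounding the modulus by the sum of the absolute values of
  the real and imaginary parts; any finite constant serves below.\<close>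

lemma Hahn_Banach_separation:
  fixes p :: "'a::complex_vector \<Rightarrow> real"
  assumes add: "\<And>x y. p (x + y) \<le> p x + p y"
    and scale: "\<And>c x. p (c *\<^sub>C x) = cmod c * p x"
    and x0: "p x0 \<noteq> 0"
  obtains f :: "'a \<Rightarrow> complex" where "clinear f" "f x0 \<noteq> 0" "\<And>x. cmod (f x) \<le> 2 * p x"
proof -
  have "sublinear p" using add scale by (simp add: sublinear_def)
  then obtain f where f: "\<And>x y. f (x + y) = f x + f y"
    "\<And>r x. f (complex_of_real r *\<^sub>C x) = r * f x" "\<And>x. f x \<le> p x" "f x0 = p x0"
    by (rule Hahn_Banach_real[of p x0]) (rule that)
  have neg: "f (- x) = - f x" for x using f(2)[of "-1" x] by (simp add: scaleC_one)
  have "p (- x) = p x" for x using scale[of "-1" x] by (simp add: scaleC_one)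
  then have abs: "\<bar>f x\<bar> \<le> p x" for x using f(3)[of x] f(3)[of "- x"] by (simp add: neg)
  define F where "F x = Complex (f x) (- f (\<i> *\<^sub>C x))" for x
  have addF: "F (x + y) = F x + F y" for x y
    by (simp add: F_def complex_eq_iff f scaleC_add_right)
  have "F (c *\<^sub>C x) = c *\<^sub>C F x" for c x
  proof -
    have f_scale: "f (d *\<^sub>C x) = Re d * f x + Im d * f (\<i> *\<^sub>C x)" for d
    proof -
      have d: "complex_of_real (Re d) + complex_of_real (Im d) * \<i> = d"
        by (simp add: complex_eq_iff)
      have "f (complex_of_real (Re d) *\<^sub>C x + complex_of_real (Im d) *\<^sub>C \<i> *\<^sub>C x)
          = Re d * f x + Im d * f (\<i> *\<^sub>C x)"
        unfolding f(1) f(2) ..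
      then show ?thesis by (simp only: scaleC_scaleC d flip: scaleC_add_left)
    qed
    show ?thesis
      using f_scale[of c] f_scale[of "\<i> * c"]
      by (simp add: F_def complex_eq_iff scaleC_complex_def scaleC_scaleC)
  qed
  with addF have "clinear F" by (intro clinearI)
  moreover have "F x0 \<noteq> 0" using x0 f(4) by (simp add: F_def complex_eq_iff)
  moreover have "cmod (F x) \<le> 2 * p x" for x
    using cmod_le[of "F x"] abs[of x] abs[of "\<i> *\<^sub>C x"] scale[of \<i> x] by (simp add: F_def)
  ultimately show ?thesis using that by blast
qed


section \<open>Slice maps on algebraic tensor products\<close>

lemma clinear_zero: "clinear f \<Longrightarrow> f 0 = 0"
  using clinear_scaleC[of f 0 0] by simp

lemma clinear_sum: "clinear f \<Longrightarrow> f (sum g S) = (\<Sum>k\<in>S. f (g k))"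
  by (induction S rule: infinite_finite_induct) (simp_all add: clinear_zero clinear_add)

lemmas tensor_simps = cbilinearD[OF cbilinear_tensor_elem]

lemma tensor_zero_right: "x \<otimes> 0 = 0"
  using tensor_simps(4)[of x 0 0] by simp

text \<open>This is id \<otimes> \<open>f\<close> from HE to H, that is, the amplification of the
  functional \<open>f\<close> with H \<otimes> C identified with H.\<close>

definition slice :: "('b::complex_vector \<Rightarrow> complex) \<Rightarrow> ('a::complex_vector, 'b) tensor \<Rightarrow> 'a"
  where "slice f = tensor_lift (\<lambda>\<xi> x. f x *\<^sub>C \<xi>)"

lemma slice:
  assumes "clinear f"
  shows "clinear (slice f)" "slice f (\<xi> \<otimes> x) = f x *\<^sub>C \<xi>"
proof -
  have "cbilinear (\<lambda>\<xi> x. f x *\<^sub>C \<xi>)"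
    using assms by (auto intro!: cbilinearI
        simp: clin_simps scaleC_add_right scaleC_add_left scaleC_scaleC scaleC_complex_def mult.commute)
  then show "clinear (slice f)" "slice f (\<xi> \<otimes> x) = f x *\<^sub>C \<xi>"
    using clinear_tensor_lift tensor_lift_elem by (auto simp: slice_def)
qed

text \<open>Elementary tensors are expanded in the left factor, and the coefficients of each vector
  of \<open>B\<close> are collected in the right factor.\<close>

lemma tensor_basis_expansion:
  fixes t :: "('a::complex_vector, 'b::complex_vector) tensor"
  assumes B: "complex_vector.span B = (UNIV :: 'a set)"
  obtains S b where "finite S" "S \<subseteq> B" "t = (\<Sum>a\<in>S. a \<otimes> b a)"
proof -
  have "\<exists>S b. finite S \<and> S \<subseteq> B \<and> t = (\<Sum>a\<in>S. a \<otimes> b a)"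
  proof (induction t rule: tensor_induct)
    case (add t u)
    then obtain S b S' b' where S: "finite S" "S \<subseteq> B" "t = (\<Sum>a\<in>S. a \<otimes> b a)"
      "finite S'" "S' \<subseteq> B" "u = (\<Sum>a\<in>S'. a \<otimes> b' a)"
      by blast
    \<comment> \<open>Padding by zero outside \<open>S\<close> and \<open>S'\<close> puts both
      expansions over a common index set.\<close>
    let ?b = "\<lambda>a. (if a \<in> S then b a else 0) + (if a \<in> S' then b' a else 0)"
    have "t = (\<Sum>a\<in>S \<union> S'. a \<otimes> (if a \<in> S then b a else 0))"
      unfolding S(3) by (rule sum.mono_neutral_cong_left) (use S(1,2,4,5) in \<open>auto simp: tensor_zero_right\<close>)
    moreover have "u = (\<Sum>a\<in>S \<union> S'. a \<otimes> (if a \<in> S' then b' a else 0))"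
      unfolding S(6) by (rule sum.mono_neutral_cong_left) (use S(1,2,4,5) in \<open>auto simp: tensor_zero_right\<close>)
    ultimately have "t + u = (\<Sum>a\<in>S \<union> S'. a \<otimes> ?b a)"
      by (simp only: tensor_simps sum.distrib)
    then show ?case using S(1,2,4,5) by (intro exI[of _ "S \<union> S'"] exI[of _ ?b]) simp
  next
    case (scale c t)
    then obtain S b where S: "finite S" "S \<subseteq> B" "t = (\<Sum>a\<in>S. a \<otimes> b a)"
      by blast
    then have "c *\<^sub>C t = (\<Sum>a\<in>S. a \<otimes> (c *\<^sub>C b a))"
      by (simp add: complex_vector.scale_sum_right tensor_simps)
    then show ?case using S(1,2) by (intro exI[of _ S] exI[of _ "\<lambda>a. c *\<^sub>C b a"]) simp
  next
    case (elem x y)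
    have "x \<in> complex_vector.span B" using B by simp
    then obtain S r where S: "finite S" "S \<subseteq> B" "x = (\<Sum>a\<in>S. r a *\<^sub>C a)"
      unfolding complex_vector.span_explicit by blast
    have "clinear (\<lambda>x::'a. x \<otimes> y)"
      by (intro clinearI) (simp_all add: tensor_simps)
    from clinear_sum[OF this, of "\<lambda>a. r a *\<^sub>C a" S]
    have "x \<otimes> y = (\<Sum>a\<in>S. a \<otimes> (r a *\<^sub>C y))"
      by (simp add: S(3) tensor_simps)
    then show ?case using S(1,2) by (intro exI[of _ S] exI[of _ "\<lambda>a. r a *\<^sub>C y"]) simp
  qed
  then show ?thesis using that by blast
qed

text \<open>Expanding \<open>t\<close> along a Hamel basis of the left factor turns each slice into
  a combination of basis vectors with coefficients \<open>f (b a)\<close>. Independence makes these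
  vanish, and \<open>\<Phi>\<close> separates points, so every \<open>b a\<close> is zero.\<close>

lemma tensor_eq_0_if_slices_eq_0:
  fixes t :: "('a::complex_vector, 'b::complex_vector) tensor"
  assumes lin: "\<And>f. f \<in> \<Phi> \<Longrightarrow> clinear f"
    and sep: "\<And>y. (\<And>f. f \<in> \<Phi> \<Longrightarrow> f y = 0) \<Longrightarrow> y = 0"
    and t: "\<And>f. f \<in> \<Phi> \<Longrightarrow> slice f t = 0"
  shows "t = 0"
proof -
  define B :: "'a set" where "B = complex_vector.extend_basis {}"
  have B: "complex_vector.independent B" "complex_vector.span B = UNIV"
    unfolding B_def by (simp_all add: complex_vector.independent_empty
        complex_vector.independent_extend_basis complex_vector.span_extend_basis)
  obtain S b where S: "finite S" "S \<subseteq> B" "t = (\<Sum>a\<in>S. a \<otimes> b a)"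
    by (rule tensor_basis_expansion[OF B(2), of t])
  have "b a = 0" if "a \<in> S" for a
  proof (rule sep)
    fix f assume f: "f \<in> \<Phi>"
    have "(\<Sum>a\<in>S. f (b a) *\<^sub>C a) = 0"
      using t[OF f] unfolding S(3) clinear_sum[OF slice(1)[OF lin[OF f]]] slice(2)[OF lin[OF f]] .
    then show "f (b a) = 0"
      by (rule complex_vector.independentD[OF B(1) S(1,2) _ that])
  qed
  then show ?thesis unfolding S(3) by (intro sum.neutral) (simp add: tensor_zero_right)
qed


section \<open>Operators on a Hilbert space\<close>

text \<open>The class provides real homogeneity of the norm; the complex one is read off from the
  inner product.\<close>

lemma norm_scaleC: "norm (c *\<^sub>C x) = cmod c * norm x"
  for x :: "'h::chilbert_space"
proof -
  have "cinner (c *\<^sub>C x) (c *\<^sub>C x) = c * cnj c * cinner x x"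
    by (metis cinner_commute cinner_scaleC_left complex_cnj_mult mult.assoc)
  then have "complex_of_real ((norm (c *\<^sub>C x))\<^sup>2) = complex_of_real ((cmod c * norm x)\<^sup>2)"
    by (simp add: cinner_self complex_norm_square[symmetric] power_mult_distrib)
  then have "(norm (c *\<^sub>C x))\<^sup>2 = (cmod c * norm x)\<^sup>2"
    using of_real_eq_iff by blast
  then show ?thesis by (rule power2_eq_imp_eq) simp_all
qed

lemma cinner_simps_right:
  fixes x :: "'h::chilbert_space"
  shows "cinner x (y + z) = cinner x y + cinner x z" "cinner x (c *\<^sub>C y) = cnj c * cinner x y"
  by (metis cinner_commute cinner_add_left complex_cnj_add)
    (metis cinner_commute cinner_scaleC_left complex_cnj_mult)

text \<open>Cauchy-Schwarz for a unit vector: the residual \<open>?y\<close> of the orthogonal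
  projection of \<open>z\<close> onto the line of \<open>w\<close> has squared norm
  \<open>(norm z)\<^sup>2 - (cmod c)\<^sup>2\<close>.\<close>

lemma cmod_cinner_le:
  fixes w :: "'h::chilbert_space"
  assumes "norm w = 1"
  shows "cmod (cinner z w) \<le> norm z"
proof -
  define c where "c = cinner z w"
  let ?y = "z + (- c) *\<^sub>C w"
  have "cinner (z + d *\<^sub>C w) (z + d *\<^sub>C w) = cinner z z + d * cnj c + cnj d * c + d * cnj d" for d
    using assms cinner_commute[of w z] cinner_self[of w]
    by (simp add: cinner_add_left cinner_scaleC_left cinner_simps_right c_def algebra_simps)
  from this[of "- c"] have "cinner ?y ?y = cinner z z - c * cnj c"
    by simp
  then have "complex_of_real ((norm ?y)\<^sup>2) = complex_of_real ((norm z)\<^sup>2 - (cmod c)\<^sup>2)"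
    by (simp add: cinner_self complex_norm_square[symmetric])
  then have "(norm ?y)\<^sup>2 = (norm z)\<^sup>2 - (cmod c)\<^sup>2"
    using of_real_eq_iff by blast
  then have "(cmod c)\<^sup>2 \<le> (norm z)\<^sup>2"
    using zero_le_power2[of "norm ?y"] by linarith
  then show ?thesis by (simp add: c_def power2_le_iff_abs_le)
qed

lemma bounded_clinearD:
  assumes "bounded_clinear a"
  shows "clinear a" "bounded_linear a"
proof -
  obtain K where K: "clinear a" "\<And>x. norm (a x) \<le> K * norm x"
    using assms by (auto simp: bounded_clinear_def)
  then show "clinear a" by blast
  show "bounded_linear a"
    by (rule bounded_linear_intro[where K = K])
      (use K in \<open>simp_all add: clin_simps scaleR_scaleC mult.commute\<close>)
qed

lemma bounded_clinear_comp:
  assumes "bounded_clinear a" "bounded_clinear b"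
  shows "bounded_clinear (a \<circ> b)"
proof -
  have "clinear (a \<circ> b)"
    using assms[THEN bounded_clinearD(1)] by (intro clinearI) (simp_all add: clin_simps)
  moreover have "bounded_linear (a \<circ> b)"
    using assms[THEN bounded_clinearD(2)] by (simp add: bounded_linear_compose o_def)
  ultimately show ?thesis
    unfolding bounded_clinear_def by (metis bounded_linear.bounded mult.commute)
qed

lemma bounded_clinear_id: "bounded_clinear (\<lambda>x. x)"
  by (auto simp: bounded_clinear_def intro!: clinearI exI[of _ 1])

lemma bounded_clinear_scaleC: "bounded_clinear (scaleC c)"
  by (auto simp: bounded_clinear_def scaleC_add_right scaleC_scaleC mult.commute norm_scaleC
      intro!: clinearI exI[of _ "cmod c"])

lemma onorm_scaleC_le: "onorm (scaleC c :: 'h::chilbert_space \<Rightarrow> 'h) \<le> cmod c"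
  by (rule onorm_bound) (simp_all add: norm_scaleC)

lemma rank_one:
  fixes w e :: "'h::chilbert_space"
  assumes "norm w = 1"
  shows "bounded_clinear (\<lambda>z. cinner z w *\<^sub>C e)" "onorm (\<lambda>z. cinner z w *\<^sub>C e) \<le> norm e"
proof -
  have le: "norm (cinner z w *\<^sub>C e) \<le> norm e * norm z" for z
    using cmod_cinner_le[OF assms, of z]
    by (simp add: norm_scaleC mult.commute[of "norm e"] mult_right_mono)
  then show "bounded_clinear (\<lambda>z. cinner z w *\<^sub>C e)"
    by (auto simp: bounded_clinear_def cinner_add_left cinner_scaleC_left scaleC_add_left
        scaleC_scaleC intro!: clinearI)
  show "onorm (\<lambda>z. cinner z w *\<^sub>C e) \<le> norm e"
    by (rule onorm_bound) (simp_all add: le)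
qed

lemma op_act_comp:
  assumes "clinear a" "clinear b"
  shows "a \<cdot> b \<cdot> u = (a \<circ> b) \<cdot> u"
proof -
  have ab: "clinear (a \<circ> b)" using assms by (intro clinearI) (simp_all add: clin_simps)
  show ?thesis
    by (induction u rule: tensor_induct)
      (simp_all add: clin_simps[OF op_act(1)] op_act(2) assms ab[unfolded o_def] o_def)
qed

text \<open>Scalars become operators, so statements about scalar multiples of tensors follow from
  those about the module action.\<close>

lemma op_act_scaleC: "scaleC c \<cdot> u = c *\<^sub>C u"
  for u :: "('h::chilbert_space, 'e::complex_vector) tensor"
proof -
  have c: "clinear (scaleC c :: 'h \<Rightarrow> 'h)" by (rule bounded_clinearD(1)[OF bounded_clinear_scaleC])
  show ?thesis
    by (induction u rule: tensor_induct)
      (simp_all add: clin_simps[OF op_act(1)[OF c]] op_act(2)[OF c] scaleC_add_right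
        scaleC_scaleC mult.commute tensor_simps)
qed

lemma op_act_id: "(\<lambda>x. x) \<cdot> u = u"
  for u :: "('h::chilbert_space, 'e::complex_vector) tensor"
proof -
  have id: "clinear (\<lambda>x::'h. x)" by (intro clinearI) simp_all
  show ?thesis
    by (induction u rule: tensor_induct) (simp_all add: clin_simps[OF op_act(1)[OF id]] op_act(2)[OF id])
qed

lemma slice_op_act:
  assumes a: "clinear a" and f: "clinear f"
  shows "slice f (a \<cdot> u) = a (slice f u)"
  by (induction u rule: tensor_induct)
    (simp_all add: clin_simps[OF op_act(1)[OF a]] op_act(2)[OF a] clin_simps[OF slice(1)[OF f]]
      slice(2)[OF f] clin_simps[OF a])


section \<open>Bounded functionals and their amplifications\<close>

text \<open>The complementary slice: the functional \<open>\<lambda>z. cinner z w\<close> on H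
  tensored with the identity of E.\<close>

definition coslice :: "'h::chilbert_space \<Rightarrow> ('h, 'e::complex_vector) tensor \<Rightarrow> 'e"
  where "coslice w = tensor_lift (\<lambda>\<xi> x. cinner \<xi> w *\<^sub>C x)"

lemma coslice:
  fixes w \<xi> :: "'h::chilbert_space" and x :: "'e::complex_vector"
  shows "clinear (coslice w :: ('h, 'e) tensor \<Rightarrow> 'e)" "coslice w (\<xi> \<otimes> x) = cinner \<xi> w *\<^sub>C x"
proof -
  have *: "cbilinear (\<lambda>\<xi> (x::'e). cinner \<xi> w *\<^sub>C x)"
    by (auto intro!: cbilinearI simp: scaleC_add_right scaleC_add_left scaleC_scaleC
        cinner_add_left cinner_scaleC_left mult.commute)
  show "clinear (coslice w :: ('h, 'e) tensor \<Rightarrow> 'e)" "coslice w (\<xi> \<otimes> x) = cinner \<xi> w *\<^sub>C x"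
    unfolding coslice_def by (rule clinear_tensor_lift[OF *] tensor_lift_elem[OF *])+
qed

text \<open>A rank one operator moves every \<open>u\<close> into \<open>e \<otimes> E\<close>,
  where a bound for functionals on E can be applied.\<close>

lemma rank_one_op_act:
  fixes w e :: "'h::chilbert_space"
  assumes "norm w = 1"
  shows "(\<lambda>z. cinner z w *\<^sub>C e) \<cdot> u = e \<otimes> coslice w u"
proof -
  have p: "clinear (\<lambda>z. cinner z w *\<^sub>C e)"
    by (rule bounded_clinearD(1)[OF rank_one(1)[OF assms]])
  show ?thesis
    by (induction u rule: tensor_induct)
      (simp_all add: clin_simps[OF op_act(1)[OF p]] op_act(2)[OF p] clin_simps[OF coslice(1)]
        coslice(2) tensor_simps)
qed

text \<open>Slicing in either order gives the same scalar: both sides apply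
  \<open>\<lambda>z. cinner z w\<close> to the H part of \<open>u\<close> and \<open>f\<close> to
  its E part.\<close>

lemma cinner_slice:
  assumes f: "clinear f"
  shows "cinner (slice f u) w = f (coslice w u)"
  by (induction u rule: tensor_induct)
    (simp_all add: clin_simps[OF slice(1)[OF f]] slice(2)[OF f] clin_simps[OF coslice(1)]
      coslice(2) clin_simps[OF f] cinner_add_left cinner_scaleC_left scaleC_complex_def)

lemma PL_seminormD:
  assumes "PL_seminorm N"
  shows "0 \<le> N u" "N (c *\<^sub>C u) = cmod c * N u" "N (u + v) \<le> N u + N v"
    "bounded_clinear a \<Longrightarrow> N (a \<cdot> u) \<le> onorm a * N u" "N 0 = 0"
proof -
  show "0 \<le> N u" "N (c *\<^sub>C u) = cmod c * N u" "N (u + v) \<le> N u + N v"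
    "bounded_clinear a \<Longrightarrow> N (a \<cdot> u) \<le> onorm a * N u" for c u v a
    using assms unfolding PL_seminorm_def by blast+
  from this(2)[of 0 0] show "N 0 = 0" by simp
qed

lemma PL_normD:
  assumes "PL_norm N"
  shows "PL_seminorm N" "N u = 0 \<longleftrightarrow> u = 0"
  using assms PL_seminormD(5)[of N] by (auto simp: PL_norm_def)

text \<open>The norm of the slice is its inner product with its own normalisation \<open>w\<close>.
  By \<open>cinner_slice\<close> this is a value of \<open>f\<close>, and the rank one operator from
  \<open>w\<close> to \<open>e\<close>, of norm at most 1, bounds it without enlarging the
  constant.\<close>

lemma norm_slice_le:
  fixes e :: "'h::chilbert_space" and N :: "('h, 'e::complex_vector) tensor \<Rightarrow> real"
  assumes e: "norm e = 1" and N: "PL_seminorm N" and f: "clinear f"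
    and K: "0 \<le> K" "\<And>x. cmod (f x) \<le> K * N (e \<otimes> x)"
  shows "norm (slice f u) \<le> K * N u"
proof (cases "slice f u = 0")
  case True
  then show ?thesis using K(1) PL_seminormD(1)[OF N] by simp
next
  case False
  define z where "z = slice f u"
  define w where "w = complex_of_real (inverse (norm z)) *\<^sub>C z"
  let ?p = "\<lambda>\<xi>. cinner \<xi> w *\<^sub>C e"
  have z: "norm z \<noteq> 0" using False by (simp add: z_def)
  have w: "norm w = 1" unfolding w_def norm_scaleC using z by (simp add: norm_inverse)
  have "cinner z w = complex_of_real (inverse (norm z) * (norm z)\<^sup>2)"
    by (simp add: w_def cinner_simps_right cinner_self)
  also have "inverse (norm z) * (norm z)\<^sup>2 = norm z" using z by (simp add: power2_eq_square)
  finally have "norm z = cmod (cinner z w)" by simp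
  also have "cinner z w = f (coslice w u)" unfolding z_def by (rule cinner_slice[OF f])
  also have "cmod \<dots> \<le> K * N (e \<otimes> coslice w u)" by (rule K(2))
  also have "N (e \<otimes> coslice w u) \<le> onorm ?p * N u"
    using PL_seminormD(4)[OF N rank_one(1)[OF w]] by (simp add: rank_one_op_act[OF w])
  also have "onorm ?p * N u \<le> N u"
    using rank_one(2)[OF w, of e] e PL_seminormD(1)[OF N, of u] by (simp add: mult_left_le_one_le
        onorm_pos_le[OF bounded_clinearD(2)[OF rank_one(1)[OF w]]])
  finally show ?thesis using K(1) by (simp add: z_def mult_left_mono)
qed

text \<open>These are the L-bounded functionals on E, where C carries the norm of H \<otimes> C =
  H.\<close>

definition PL_functional :: "(('h::chilbert_space, 'e::complex_vector) tensor \<Rightarrow> real)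
    \<Rightarrow> ('e \<Rightarrow> complex) \<Rightarrow> bool"
  where "PL_functional N f \<longleftrightarrow> clinear f \<and> (\<exists>K\<ge>0. \<forall>u. norm (slice f u) \<le> K * N u)"

text \<open>Hahn-Banach is applied to \<open>\<lambda>y. N (e \<otimes> y)\<close>, and
  \<open>norm_slice_le\<close> makes the resulting functional L-bounded.\<close>

lemma PL_functional_separation:
  fixes e :: "'h::chilbert_space" and N :: "('h, 'e::complex_vector) tensor \<Rightarrow> real"
  assumes e: "norm e = 1" and N: "PL_norm N" and x: "\<And>f. PL_functional N f \<Longrightarrow> f x = 0"
  shows "x = 0"
proof (rule ccontr)
  assume "x \<noteq> 0"
  note S = PL_seminormD[OF PL_normD(1)[OF N]]
  \<comment> \<open>\<open>coslice e\<close> is a left inverse of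
    \<open>\<lambda>x. e \<otimes> x\<close>, so \<open>e \<otimes> x\<close> does not
    vanish.\<close>
  have "coslice e (e \<otimes> x) = x" by (simp add: coslice(2) cinner_self e scaleC_one)
  then have "e \<otimes> x \<noteq> 0" using \<open>x \<noteq> 0\<close> clin_simps(2)[OF coslice(1)[of e], of 0 0] by auto
  then have "N (e \<otimes> x) \<noteq> 0" by (simp add: PL_normD(2)[OF N])
  then obtain f where f: "clinear f" "f x \<noteq> 0" "\<And>y. cmod (f y) \<le> 2 * N (e \<otimes> y)"
    by (rule Hahn_Banach_separation[rotated 2]) (simp_all add: S tensor_simps)
  then have "PL_functional N f"
    using norm_slice_le[OF e PL_normD(1)[OF N] f(1), of 2]
    unfolding PL_functional_def by (auto intro!: exI[of _ 2])
  with x f(2) show False by blast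
qed

definition tensor_functional :: "('e::complex_vector \<Rightarrow> complex) \<Rightarrow> ('f::complex_vector \<Rightarrow> complex)
    \<Rightarrow> ('e, 'f) tensor \<Rightarrow> complex"
  where "tensor_functional f g = tensor_lift (\<lambda>x y. f x * g y)"

lemma tensor_functional:
  assumes "clinear f" "clinear g"
  shows "clinear (tensor_functional f g)" "tensor_functional f g (x \<otimes> y) = f x * g y"
proof -
  have "cbilinear (\<lambda>x y. f x * g y)"
    by (intro cbilinearI) (simp_all add: clin_simps[OF assms(1)] clin_simps[OF assms(2)]
        scaleC_complex_def algebra_simps)
  then show "clinear (tensor_functional f g)" "tensor_functional f g (x \<otimes> y) = f x * g y"
    using clinear_tensor_lift tensor_lift_elem by (auto simp: tensor_functional_def)
qed

text \<open>Splits the product functional into a slice by \<open>g\<close> followed by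
  \<open>f\<close>, so that points of E \<otimes> F can be separated one factor at a time.\<close>

lemma apply_slice:
  assumes f: "clinear f" and g: "clinear g"
  shows "f (slice g w) = tensor_functional f g w"
  by (induction w rule: tensor_induct)
    (simp_all add: clin_simps[OF slice(1)[OF g]] slice(2)[OF g] clin_simps[OF f]
      clin_simps[OF tensor_functional(1)[OF f g]] tensor_functional(2)[OF f g]
      scaleC_complex_def mult.commute)

text \<open>The amplification of the product functional splits along \<diamondsuit>; with a
  multiplicative norm of \<open>d\<close> this bounds it on each summand of a
  representation.\<close>

lemma slice_tensor_diamond:
  fixes d :: "'h::chilbert_space \<Rightarrow> 'h \<Rightarrow> 'h"
  assumes d: "cbilinear d" and f: "clinear f" and g: "clinear g"
  shows "slice (tensor_functional f g) (tensor_diamond d u v) = d (slice f u) (slice g v)"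
proof -
  note T = bilinear_amp[OF d cbilinear_tensor_elem, folded tensor_diamond_eq]
  note simps = cbilinearD[OF T(1)] cbilinearD[OF d] clin_simps[OF slice(1)[OF f]]
    clin_simps[OF slice(1)[OF g]] clin_simps[OF slice(1)[OF tensor_functional(1)[OF f g]]]
  have "slice (tensor_functional f g) (tensor_diamond d (\<xi> \<otimes> x) v) = d (slice f (\<xi> \<otimes> x)) (slice g v)"
    for \<xi> x
    by (induction v rule: tensor_induct)
      (simp_all add: simps T(2) slice(2)[OF f] slice(2)[OF g] slice(2)[OF tensor_functional(1)[OF f g]]
        tensor_functional(2)[OF f g] scaleC_scaleC mult.commute)
  then show ?thesis
    by (induction u rule: tensor_induct) (simp_all add: simps)
qed


section \<open>The \<open>PL\<close>-tensor product\<close>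

text \<open>The slice criterion is used twice: on H \<otimes> (E \<otimes> F), where it asks the
  product functionals to separate E \<otimes> F, and then on E \<otimes> F, with slices by
  functionals of F whose values are separated by functionals of E.\<close>

lemma separating_tensor_functionals:
  fixes e :: "'h::chilbert_space" and U :: "('h, ('e::complex_vector, 'f::complex_vector) tensor) tensor"
    and NE :: "('h, 'e) tensor \<Rightarrow> real" and NF :: "('h, 'f) tensor \<Rightarrow> real"
  assumes e: "norm e = 1" and NE: "PL_norm NE" and NF: "PL_norm NF"
    and U: "\<And>f g. PL_functional NE f \<Longrightarrow> PL_functional NF g \<Longrightarrow> slice (tensor_functional f g) U = 0"
  shows "U = 0"
proof (rule tensor_eq_0_if_slices_eq_0)
  let ?\<Phi> = "{tensor_functional f g | f g. PL_functional NE f \<and> PL_functional NF g}"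
  show "clinear \<phi>" if "\<phi> \<in> ?\<Phi>" for \<phi>
    using that tensor_functional(1) by (auto simp: PL_functional_def)
  show "slice \<phi> U = 0" if "\<phi> \<in> ?\<Phi>" for \<phi>
    using that U by auto
  fix w assume w: "\<And>\<phi>. \<phi> \<in> ?\<Phi> \<Longrightarrow> \<phi> w = 0"
  show "w = 0"
  proof (rule tensor_eq_0_if_slices_eq_0[where \<Phi> = "{g. PL_functional NF g}"])
    show "clinear g" if "g \<in> {g. PL_functional NF g}" for g
      using that by (simp add: PL_functional_def)
    show "y = 0" if "\<And>g. g \<in> {g. PL_functional NF g} \<Longrightarrow> g y = 0" for y
      using that by (intro PL_functional_separation[OF e NF]) simp
    fix g assume g: "g \<in> {g. PL_functional NF g}"
    show "slice g w = 0"
    proof (rule PL_functional_separation[OF e NE])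
      fix f assume f: "PL_functional NE f"
      have "f (slice g w) = tensor_functional f g w"
        using f g by (intro apply_slice) (auto simp: PL_functional_def)
      also have "\<dots> = 0" using f g by (intro w) auto
      finally show "f (slice g w) = 0" .
    qed
  qed
qed

section \<open>Linear amplifications, the module action and \<diamondsuit>\<close>

lemma amp_op_act:
  assumes R: "clinear R" and a: "clinear a"
  shows "amp R (a \<cdot> u) = a \<cdot> amp R u"
  by (induction u rule: tensor_induct)
    (simp_all add: clin_simps[OF amp(1)[OF R]] amp(2)[OF R] clin_simps[OF op_act(1)[OF a]]
      op_act(2)[OF a])

text \<open>Both sides are bilinear in \<open>u\<close>, \<open>v\<close> and agree on elementary
  tensors. This carries bounds between \<open>R\<close> and \<open>Q\<close> in both
  directions.\<close>

lemma amp_tensor_diamond: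
  assumes d: "cbilinear d" and R: "clinear R" "\<And>x y. R (x \<otimes> y) = Q x y" and Q: "cbilinear Q"
  shows "amp R (tensor_diamond d u v) = bilinear_amp d Q u v"
proof -
  note T = bilinear_amp[OF d cbilinear_tensor_elem, folded tensor_diamond_eq]
    and B = bilinear_amp[OF d Q]
  note simps = cbilinearD[OF T(1)] cbilinearD[OF B(1)] clin_simps[OF amp(1)[OF R(1)]]
  have "amp R (tensor_diamond d (\<xi> \<otimes> x) v) = bilinear_amp d Q (\<xi> \<otimes> x) v" for \<xi> x
    by (induction v rule: tensor_induct) (simp_all add: simps T(2) B(2) amp(2)[OF R(1)] R(2))
  then show ?thesis
    by (induction u rule: tensor_induct) (simp_all add: simps)
qed

text \<open>The operation \<diamondsuit> enters only through bilinearity and multiplicativity of the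
  norm; \<open>e\<close> is an auxiliary unit vector for building rank one operators and
  functionals.\<close>

locale pl_tensor =
  fixes d :: "'h::chilbert_space \<Rightarrow> 'h \<Rightarrow> 'h"
    and NE :: "('h, 'e::complex_vector) tensor \<Rightarrow> real"
    and NF :: "('h, 'f::complex_vector) tensor \<Rightarrow> real"
    and e :: 'h
  assumes d: "cbilinear d" and norm_d: "norm (d \<xi> \<eta>) = norm \<xi> * norm \<eta>"
    and NE: "PL_norm NE" and NF: "PL_norm NF" and e: "norm e = 1"
begin

abbreviation pl :: "('h, ('e, 'f) tensor) tensor \<Rightarrow> real"
  where "pl \<equiv> pl_norm d NE NF"

abbreviation diam :: "('h, 'e) tensor \<Rightarrow> ('h, 'f) tensor \<Rightarrow> ('h, ('e, 'f) tensor) tensor"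
    (infixr "\<diamondsuit>" 75)
  where "u \<diamondsuit> v \<equiv> tensor_diamond d u v"

lemmas NE_simps = PL_seminormD[OF PL_normD(1)[OF NE]]
lemmas NF_simps = PL_seminormD[OF PL_normD(1)[OF NF]]
lemmas diam_elem = bilinear_amp(2)[OF d cbilinear_tensor_elem, folded tensor_diamond_eq]

text \<open>\<open>pl_rep U c\<close>: some representation of \<open>U\<close> as in \<open>pl_norm\<close> has cost \<open>c\<close>.\<close>

inductive pl_rep :: "('h, ('e, 'f) tensor) tensor \<Rightarrow> real \<Rightarrow> bool" where
  zero: "pl_rep 0 0"
| step: "pl_rep U c \<Longrightarrow> bounded_clinear a \<Longrightarrow>
    pl_rep (U + a \<cdot> u \<diamondsuit> v) (c + onorm a * NE u * NF v)"

section \<open>Representations of a tensor and their costs\<close>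

lemma pl_rep_sum:
  fixes n :: nat
  assumes "\<And>k. k < n \<Longrightarrow> bounded_clinear (a k)"
  shows "pl_rep (\<Sum>k<n. a k \<cdot> u k \<diamondsuit> v k) (\<Sum>k<n. onorm (a k) * NE (u k) * NF (v k))"
  using assms by (induction n) (auto intro: pl_rep.intros)

lemma pl_rep_sumE:
  assumes "pl_rep U c"
  shows "\<exists>(n::nat) a u v. (\<forall>k<n. bounded_clinear (a k)) \<and> U = (\<Sum>k<n. a k \<cdot> u k \<diamondsuit> v k)
    \<and> c = (\<Sum>k<n. onorm (a k) * NE (u k) * NF (v k))"
  using assms
proof induction
  case zero
  show ?case by (intro exI[of _ 0]) simp
next
  case (step U c b s t)
  from step.IH obtain n :: nat and a u v where *: "\<forall>k<n. bounded_clinear (a k)" "U = (\<Sum>k<n. a k \<cdot> u k \<diamondsuit> v k)"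
    "c = (\<Sum>k<n. onorm (a k) * NE (u k) * NF (v k))"
    by blast
  show ?case
    \<comment> \<open>The new triple is stored at index \<open>n\<close>, which the sums over
      \<open>k < n\<close> never read.\<close>
    by (intro exI[of _ "Suc n"] exI[of _ "a(n := b)"] exI[of _ "u(n := s)"] exI[of _ "v(n := t)"])
      (use * step(2) in \<open>simp add: less_Suc_eq\<close>)
qed

text \<open>The two sets of costs coincide, so estimates on \<open>pl\<close> can be proved by
  induction, one summand at a time.\<close>

lemma pl_norm_eq_Inf: "pl U = Inf {c. pl_rep U c}"
proof -
  have "{c. pl_rep U c} = {(\<Sum>k<n. onorm (a k) * NE (u k) * NF (v k)) | (n::nat) a u v.
      (\<forall>k<n. bounded_clinear (a k)) \<and> U = (\<Sum>k<n. a k \<cdot> u k \<diamondsuit> v k)}"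
    using pl_rep_sumE pl_rep_sum by blast
  then show ?thesis by (simp add: pl_norm_def)
qed

lemma pl_rep_elementary: "bounded_clinear a \<Longrightarrow> pl_rep (a \<cdot> u \<diamondsuit> v) (onorm a * NE u * NF v)"
  using pl_rep.step[OF pl_rep.zero] by simp

lemma pl_rep_add:
  assumes "pl_rep V c'" "pl_rep U c"
  shows "pl_rep (U + V) (c + c')"
  using assms
proof induction
  case (step V c' a u v)
  then show ?case using pl_rep.step[of "U + V" "c + c'" a u v] by (simp add: add.assoc)
qed simp

text \<open>\<open>b\<close> is absorbed into every coefficient. The new cost is only bounded,
  because the operator norm is merely submultiplicative.\<close>

lemma pl_rep_op_act:
  assumes "pl_rep U c" and b: "bounded_clinear b"
  shows "\<exists>c'. pl_rep (b \<cdot> U) c' \<and> c' \<le> onorm b * c"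
  using assms(1)
proof induction
  case zero
  have "b \<cdot> (0 :: ('h, ('e, 'f) tensor) tensor) = 0"
    by (rule clinear_zero[OF op_act(1)[OF bounded_clinearD(1)[OF b]]])
  then show ?case using pl_rep.zero by auto
next
  case (step U c a u v)
  then obtain c' where c': "pl_rep (b \<cdot> U) c'" "c' \<le> onorm b * c" by blast
  note lin = bounded_clinearD(1)[OF b] bounded_clinearD(1)[OF step(2)]
  have "b \<cdot> (U + a \<cdot> u \<diamondsuit> v) = b \<cdot> U + (b \<circ> a) \<cdot> u \<diamondsuit> v"
    using lin by (simp add: clinear_add[OF op_act(1)] op_act_comp)
  moreover have "onorm (b \<circ> a) * NE u * NF v \<le> onorm b * onorm a * NE u * NF v"
    by (intro mult_right_mono onorm_compose bounded_clinearD b step NE_simps NF_simps)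
  ultimately show ?case
    using pl_rep.step[OF c'(1) bounded_clinear_comp[OF b step(2)], of u v] c'(2)
    by (intro exI[of _ "c' + onorm (b \<circ> a) * NE u * NF v"]) (simp add: algebra_simps)
qed

text \<open>Sums concatenate and scalars act as operators, so only
  \<open>\<zeta> \<otimes> (x \<otimes> y)\<close> needs an explicit representation.\<close>

lemma pl_rep_exists: "\<exists>c. pl_rep U c"
proof (induction U rule: tensor_induct)
  case (add U V)
  then show ?case using pl_rep_add by blast
next
  case (scale c U)
  then show ?case using pl_rep_op_act[OF _ bounded_clinear_scaleC[of c]] by (metis op_act_scaleC)
next
  case (elem \<zeta> w)
  show ?case
  proof (induction w rule: tensor_induct)
    case (add w w')
    then show ?case using pl_rep_add by (metis tensor_simps(2))
  next
    case (scale c w)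
    then show ?case using pl_rep_op_act[OF _ bounded_clinear_scaleC[of c]]
      by (metis op_act_scaleC tensor_simps(4))
  next
    case (elem x y)
    have n: "norm (d e e) = 1" by (simp add: norm_d e)
    \<comment> \<open>This operator sends the unit vector \<open>d e e\<close> to
      \<open>\<zeta>\<close>.\<close>
    let ?a = "\<lambda>z. cinner z (d e e) *\<^sub>C \<zeta>"
    have "?a \<cdot> ((e \<otimes> x) \<diamondsuit> (e \<otimes> y)) = \<zeta> \<otimes> (x \<otimes> y)"
      unfolding diam_elem op_act(2)[OF bounded_clinearD(1)[OF rank_one(1)[OF n]]]
      by (simp add: cinner_self n scaleC_one)
    then show ?case using pl_rep_elementary[OF rank_one(1)[OF n]] by metis
  qed
qed

section \<open>The infimum of the costs\<close>

lemma onorm_mult_nonneg: "bounded_clinear a \<Longrightarrow> 0 \<le> onorm a * NE u * NF v"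
  by (intro mult_nonneg_nonneg onorm_pos_le bounded_clinearD NE_simps NF_simps)

lemma pl_rep_nonneg: "pl_rep U c \<Longrightarrow> 0 \<le> c"
  by (induction rule: pl_rep.induct) (simp_all add: onorm_mult_nonneg)

lemma pl_norm_le: "pl_rep U c \<Longrightarrow> pl U \<le> c"
  unfolding pl_norm_eq_Inf by (rule cInf_lower) (auto intro!: bdd_belowI[of _ 0] pl_rep_nonneg)

lemma pl_norm_ge: "(\<And>c. pl_rep U c \<Longrightarrow> b \<le> c) \<Longrightarrow> b \<le> pl U"
  unfolding pl_norm_eq_Inf using pl_rep_exists[of U] by (intro cInf_greatest) auto

text \<open>Bounds by a multiple of \<open>pl\<close> are obtained in this form. For
  \<open>K = 0\<close>, where division is impossible, the existence of one representation gives
  \<open>b \<le> 0\<close>.\<close>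

lemma le_mult_pl_norm:
  assumes "0 \<le> K" and le: "\<And>c. pl_rep U c \<Longrightarrow> b \<le> K * c"
  shows "b \<le> K * pl U"
proof (cases "K = 0")
  case True
  then show ?thesis using pl_rep_exists[of U] le by auto
next
  case False
  then have "0 < K" using assms(1) by simp
  then have "b / K \<le> pl U" by (intro pl_norm_ge) (simp add: le pos_divide_le_eq mult.commute[of _ K])
  then show ?thesis using \<open>0 < K\<close> by (simp add: field_simps)
qed

lemma PL_seminorm_pl: "PL_seminorm pl"
proof -
  have nonneg: "0 \<le> pl U" for U by (rule pl_norm_ge) (rule pl_rep_nonneg)
  have act: "pl (a \<cdot> U) \<le> onorm a * pl U" if a: "bounded_clinear a" for a U
  proof (rule le_mult_pl_norm)
    show "0 \<le> onorm a" by (rule onorm_pos_le[OF bounded_clinearD(2)[OF a]])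
    fix c assume "pl_rep U c"
    then show "pl (a \<cdot> U) \<le> onorm a * c"
      using pl_rep_op_act[OF _ a] pl_norm_le by (meson order_trans)
  qed
  have scale_le: "pl (c *\<^sub>C U) \<le> cmod c * pl U" for c U
  proof -
    have "pl (c *\<^sub>C U) \<le> onorm (scaleC c :: 'h \<Rightarrow> 'h) * pl U"
      using act[OF bounded_clinear_scaleC] by (simp add: op_act_scaleC)
    also have "\<dots> \<le> cmod c * pl U" by (intro mult_right_mono onorm_scaleC_le nonneg)
    finally show ?thesis .
  qed
  \<comment> \<open>For nonzero \<open>c\<close> the reverse inequality is \<open>scale_le\<close>
    for \<open>inverse c\<close>.\<close>
  have scale: "pl (c *\<^sub>C U) = cmod c * pl U" for c U
  proof (cases "c = 0")
    case True
    then show ?thesis using scale_le[of 0 U] nonneg[of 0] by simp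
  next
    case False
    then have "pl U \<le> cmod (inverse c) * pl (c *\<^sub>C U)"
      using scale_le[of "inverse c" "c *\<^sub>C U"] by (simp add: scaleC_scaleC scaleC_one)
    then show ?thesis using scale_le[of c U] False by (simp add: norm_divide field_simps)
  qed
  have "pl (U + V) \<le> pl U + pl V" for U V
  proof -
    \<comment> \<open>A representation of \<open>U\<close> is kept fixed while the infimum over
      those of \<open>V\<close> is taken.\<close>
    have "pl (U + V) - c \<le> pl V" if c: "pl_rep U c" for c
    proof (rule pl_norm_ge)
      fix c' assume "pl_rep V c'"
      from pl_norm_le[OF pl_rep_add[OF this c]] show "pl (U + V) - c \<le> c'" by simp
    qed
    then have "pl (U + V) - pl V \<le> pl U" by (intro pl_norm_ge) (simp add: algebra_simps)
    then show ?thesis by simp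
  qed
  with nonneg scale act show ?thesis unfolding PL_seminorm_def by blast
qed

text \<open>Each summand is sent to \<open>a (d (slice f u) (slice g v))\<close>, whose norm is at
  most \<open>K * L\<close> times its cost by \<open>norm_d\<close>.\<close>

lemma norm_slice_le_pl:
  assumes f: "clinear f" "0 \<le> K" "\<And>u. norm (slice f u) \<le> K * NE u"
    and g: "clinear g" "0 \<le> L" "\<And>v. norm (slice g v) \<le> L * NF v"
  shows "norm (slice (tensor_functional f g) U) \<le> K * L * pl U"
proof (rule le_mult_pl_norm)
  let ?s = "slice (tensor_functional f g)"
  note s = slice(1)[OF tensor_functional(1)[OF f(1) g(1)]]
  show "norm (?s U) \<le> K * L * c" if "pl_rep U c" for c
    using that
  proof induction
    case zero
    show ?case by (simp add: clinear_zero[OF s])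
  next
    case (step U c a u v)
    have "?s (a \<cdot> u \<diamondsuit> v) = a (d (slice f u) (slice g v))"
      by (simp only: slice_op_act[OF bounded_clinearD(1)[OF step(2)] tensor_functional(1)[OF f(1) g(1)]]
          slice_tensor_diamond[OF d f(1) g(1)])
    then have "norm (?s (a \<cdot> u \<diamondsuit> v)) \<le> onorm a * (norm (slice f u) * norm (slice g v))"
      using onorm[OF bounded_clinearD(2)[OF step(2)]] by (metis norm_d)
    also have "\<dots> \<le> onorm a * ((K * NE u) * (L * NF v))"
      by (intro mult_left_mono mult_mono f g mult_nonneg_nonneg NE_simps norm_ge_zero
          onorm_pos_le bounded_clinearD step)
    finally have "norm (?s (a \<cdot> u \<diamondsuit> v)) \<le> K * L * (onorm a * NE u * NF v)"
      by (simp add: mult_ac)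
    then show ?case
      using step.IH norm_triangle_ineq[of "?s U" "?s (a \<cdot> u \<diamondsuit> v)"]
      by (simp add: clinear_add[OF s] distrib_left)
  qed
qed (use f g in simp)

text \<open>If \<open>pl U\<close> vanishes, \<open>norm_slice_le_pl\<close> annihilates all slices
  of \<open>U\<close> by product functionals, and these separate points.\<close>

lemma PL_norm_pl: "PL_norm pl"
  unfolding PL_norm_def
proof (intro conjI allI impI PL_seminorm_pl)
  fix U assume U: "pl U = 0"
  show "U = 0"
  proof (rule separating_tensor_functionals[OF e NE NF])
    fix f g assume "PL_functional NE f" "PL_functional NF g"
    then obtain K L where "clinear f" "0 \<le> K" "\<And>u. norm (slice f u) \<le> K * NE u"
      "clinear g" "0 \<le> L" "\<And>v. norm (slice g v) \<le> L * NF v"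
      unfolding PL_functional_def by blast
    from norm_slice_le_pl[OF this, of U] show "slice (tensor_functional f g) U = 0"
      by (simp add: U)
  qed
qed

text \<open>One-term representation with the identity as coefficient.\<close>

lemma pl_diam_le: "pl (u \<diamondsuit> v) \<le> NE u * NF v"
proof -
  have "pl (u \<diamondsuit> v) \<le> onorm (\<lambda>x::'h. x) * NE u * NF v"
    using pl_norm_le[OF pl_rep_elementary[OF bounded_clinear_id]] by (simp add: op_act_id)
  also have "\<dots> \<le> 1 * NE u * NF v"
    by (intro mult_right_mono onorm_id_le NE_simps NF_simps)
  finally show ?thesis by simp
qed

lemma L_contractive_tensor_elem: "L_contractive_bilinear d NE NF pl (\<otimes>)"
  using pl_diam_le by (simp add: L_contractive_bilinear_def cbilinear_tensor_elem tensor_diamond_eq)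

section \<open>The universal property and the equality of norms\<close>

context
  fixes NG :: "('h, 'g::complex_vector) tensor \<Rightarrow> real" and Q :: "'e \<Rightarrow> 'f \<Rightarrow> 'g"
  assumes NG: "PL_norm NG" and Q: "L_bounded_bilinear d NE NF NG Q"
begin

lemmas NG_simps = PL_seminormD[OF PL_normD(1)[OF NG]]

lemma Q_bilinear: "cbilinear Q"
  using Q by (simp add: L_bounded_bilinear_def)

lemma bilinear_amp_bound:
  obtains C where "0 \<le> C" "\<And>u v. NG (bilinear_amp d Q u v) \<le> C * NE u * NF v"
proof -
  obtain C where C: "\<And>u v. NG (bilinear_amp d Q u v) \<le> C * NE u * NF v"
    using Q unfolding L_bounded_bilinear_def by blast
  \<comment> \<open>L-boundedness puts no sign on \<open>C\<close>; a nonnegative constant is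
    required by \<open>le_mult_pl_norm\<close>.\<close>
  have "C * NE u * NF v \<le> max C 0 * NE u * NF v" for u v
    by (intro mult_right_mono NE_simps NF_simps) simp
  then show ?thesis using C that[of "max C 0"] by (meson max.cobounded2 order_trans)
qed

text \<open>The amplification of \<open>R\<close> commutes with operators and turns \<diamondsuit>
  into the amplification of \<open>Q\<close>, so a representation of cost \<open>c\<close> has an
  image of norm at most \<open>C * c\<close>.\<close>

lemma amp_le_pl:
  assumes R: "clinear R" "\<And>x y. R (x \<otimes> y) = Q x y"
    and C: "0 \<le> C" "\<And>u v. NG (bilinear_amp d Q u v) \<le> C * NE u * NF v"
  shows "NG (amp R U) \<le> C * pl U"
proof (rule le_mult_pl_norm[OF C(1)])
  show "NG (amp R U) \<le> C * c" if "pl_rep U c" for c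
    using that
  proof induction
    case zero
    show ?case by (simp add: clinear_zero[OF amp(1)[OF R(1)]] NG_simps)
  next
    case (step U c a u v)
    have "NG (amp R (a \<cdot> u \<diamondsuit> v)) = NG (a \<cdot> bilinear_amp d Q u v)"
      by (simp add: amp_op_act[OF R(1) bounded_clinearD(1)[OF step(2)]]
          amp_tensor_diamond[OF d R Q_bilinear])
    also have "\<dots> \<le> onorm a * NG (bilinear_amp d Q u v)" by (rule NG_simps(4)[OF step(2)])
    also have "\<dots> \<le> onorm a * (C * NE u * NF v)"
      by (intro mult_left_mono C onorm_pos_le bounded_clinearD step)
    finally have "NG (amp R (a \<cdot> u \<diamondsuit> v)) \<le> C * (onorm a * NE u * NF v)"
      by (simp add: mult_ac)
    then show ?case
      using step.IH NG_simps(3)[of "amp R U" "amp R (a \<cdot> u \<diamondsuit> v)"]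
      by (simp add: clinear_add[OF amp(1)[OF R(1)]] distrib_left)
  qed
qed

text \<open>By \<open>amp_le_pl\<close> every linear factorisation of \<open>Q\<close> is L-bounded,
  so the claim reduces to the universal property of the algebraic tensor product.\<close>

lemma universal_property: "\<exists>!R. L_bounded pl NG R \<and> (\<forall>x y. R (x \<otimes> y) = Q x y)"
proof -
  obtain C where C: "0 \<le> C" "\<And>u v. NG (bilinear_amp d Q u v) \<le> C * NE u * NF v"
    using bilinear_amp_bound by blast
  have "(L_bounded pl NG R \<and> (\<forall>x y. R (x \<otimes> y) = Q x y))
      \<longleftrightarrow> clinear R \<and> (\<forall>x y. R (x \<otimes> y) = Q x y)" for R
    using amp_le_pl[OF _ _ C] by (auto simp: L_bounded_def)
  then show ?thesis using tensor_lift_unique_existence[OF Q_bilinear] by simp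
qed

lemma bilinear_amp_le_lb_norm:
  "0 \<le> lb_norm_bilinear d NE NF NG Q"
  "NG (bilinear_amp d Q u v) \<le> lb_norm_bilinear d NE NF NG Q * NE u * NF v"
proof -
  obtain C where C: "0 \<le> C" "\<And>u v. NG (bilinear_amp d Q u v) \<le> C * NE u * NF v"
    using bilinear_amp_bound by blast
  let ?S = "{NG (bilinear_amp d Q u v) | u v. NE u \<le> 1 \<and> NF v \<le> 1}"
  let ?M = "lb_norm_bilinear d NE NF NG Q"
  note B = cbilinearD[OF bilinear_amp(1)[OF d Q_bilinear]]
  \<comment> \<open>A real \<open>Sup\<close> is an upper bound only for a set known to be bounded
    above.\<close>
  have "bdd_above ?S"
  proof (rule bdd_aboveI[of _ C])
    fix r assume "r \<in> ?S"
    then obtain u v where r: "r = NG (bilinear_amp d Q u v)" "NE u \<le> 1" "NF v \<le> 1" by blast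
    have "r \<le> C * (NE u * NF v)" using C(2)[of u v] by (simp add: r(1) mult.assoc)
    also have "\<dots> \<le> C * 1"
      using mult_mono[OF r(2,3)] by (intro mult_left_mono C) (simp_all add: NF_simps)
    finally show "r \<le> C" by simp
  qed
  then have upper: "NG (bilinear_amp d Q u v) \<le> ?M" if "NE u \<le> 1" "NF v \<le> 1" for u v
    unfolding lb_norm_bilinear_def using that by (intro cSup_upper) auto
  have "0 \<le> NG (bilinear_amp d Q 0 0)" by (rule NG_simps)
  also have "\<dots> \<le> ?M" by (rule upper) (simp_all add: NE_simps NF_simps)
  finally show "0 \<le> ?M" .
  show "NG (bilinear_amp d Q u v) \<le> ?M * NE u * NF v"
  \<comment> \<open>Vectors of norm zero cannot be normalised; there the bound with \<open>C\<close>
    already gives zero.\<close>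
  proof (cases "NE u = 0 \<or> NF v = 0")
    case True
    then have "NG (bilinear_amp d Q u v) \<le> 0" using C(2)[of u v] by auto
    then show ?thesis using True by auto
  next
    case False
    then have pos: "0 < NE u" "0 < NF v"
      using NE_simps(1)[of u] NF_simps(1)[of v] by linarith+
    let ?r = "complex_of_real (inverse (NE u))" and ?s = "complex_of_real (inverse (NF v))"
    have "NG (bilinear_amp d Q (?r *\<^sub>C u) (?s *\<^sub>C v)) \<le> ?M"
      using pos by (intro upper) (simp_all only: NE_simps NF_simps norm_of_real, simp_all)
    moreover have "NG (bilinear_amp d Q (?r *\<^sub>C u) (?s *\<^sub>C v))
        = inverse (NE u) * (inverse (NF v) * NG (bilinear_amp d Q u v))"
      using pos by (simp only: B NG_simps norm_of_real) simp
    ultimately have "inverse (NE u) * (inverse (NF v) * NG (bilinear_amp d Q u v)) \<le> ?M"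
      by (simp only:)
    then show ?thesis using pos by (simp add: field_simps)
  qed
qed

text \<open>One inequality is \<open>amp_le_pl\<close> with the norm of \<open>Q\<close> as
  constant. For the other, \<open>u \<diamondsuit> v\<close> lies in the unit ball of
  \<open>pl\<close> whenever \<open>u\<close> and \<open>v\<close> lie in theirs.\<close>

lemma lb_norm_eq:
  assumes R: "clinear R" "\<And>x y. R (x \<otimes> y) = Q x y"
  shows "lb_norm pl NG R = lb_norm_bilinear d NE NF NG Q"
proof (rule antisym)
  let ?M = "lb_norm_bilinear d NE NF NG Q"
  let ?T = "{NG (amp R U) | U. pl U \<le> 1}"
  have T: "r \<le> ?M" if "r \<in> ?T" for r
  proof -
    obtain U where r: "r = NG (amp R U)" "pl U \<le> 1" using \<open>r \<in> ?T\<close> by blast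
    have "r \<le> ?M * pl U"
      unfolding r(1) by (rule amp_le_pl[OF R bilinear_amp_le_lb_norm])
    also have "\<dots> \<le> ?M" using r(2) bilinear_amp_le_lb_norm(1) by (rule mult_left_le)
    finally show ?thesis .
  qed
  have "pl 0 \<le> 1" by (simp add: PL_seminormD(5)[OF PL_seminorm_pl])
  then have "?T \<noteq> {}" by blast
  then show "lb_norm pl NG R \<le> ?M"
    unfolding lb_norm_def using T by (rule cSup_least)
  have "NG (bilinear_amp d Q u v) \<le> lb_norm pl NG R" if "NE u \<le> 1" "NF v \<le> 1" for u v
  proof -
    have "pl (u \<diamondsuit> v) \<le> NE u * NF v" by (rule pl_diam_le)
    also have "\<dots> \<le> 1" using mult_mono[OF that] by (simp add: NF_simps)
    finally have "NG (amp R (u \<diamondsuit> v)) \<in> ?T" by blast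
    then have "NG (amp R (u \<diamondsuit> v)) \<le> lb_norm pl NG R"
      unfolding lb_norm_def using T by (intro cSup_upper bdd_aboveI[of _ ?M])
    then show ?thesis by (simp add: amp_tensor_diamond[OF d R Q_bilinear])
  qed
  moreover have "\<exists>u v. NE u \<le> 1 \<and> NF v \<le> 1"
    by (intro exI[of _ 0]) (simp add: NE_simps NF_simps)
  ultimately show "?M \<le> lb_norm pl NG R"
    unfolding lb_norm_bilinear_def by (intro cSup_least) auto
qed

end

end

section \<open>The concrete operation \<diamondsuit> on H\<close>

lemma diamond:
  fixes j :: "('h::chilbert_space, 'h) tensor \<Rightarrow> 'k::chilbert_space"
  assumes j: "hilbert_tensor_square j" and \<iota>: "unitary \<iota>"
  shows "cbilinear (diamond j \<iota>)" "norm (diamond j \<iota> \<xi> \<eta>) = norm \<xi> * norm \<eta>"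
proof -
  have lin: "clinear j" "clinear \<iota>" using j \<iota> by (simp_all add: hilbert_tensor_square_def unitary_def)
  show "cbilinear (diamond j \<iota>)"
    by (intro cbilinearI)
      (simp_all add: diamond_def tensor_simps clin_simps[OF lin(1)] clin_simps[OF lin(2)])
  \<comment> \<open>\<open>j\<close> multiplies inner products of elementary tensors and
    \<open>\<iota>\<close> preserves them.\<close>
  have "cinner (diamond j \<iota> \<xi> \<eta>) (diamond j \<iota> \<xi> \<eta>) = cinner \<xi> \<xi> * cinner \<eta> \<eta>"
    using j \<iota> by (simp add: hilbert_tensor_square_def unitary_def diamond_def)
  then have "(norm (diamond j \<iota> \<xi> \<eta>))\<^sup>2 = (norm \<xi> * norm \<eta>)\<^sup>2"
    unfolding cinner_self power_mult_distrib of_real_mult[symmetric] of_real_eq_iff .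
  then show "norm (diamond j \<iota> \<xi> \<eta>) = norm \<xi> * norm \<eta>"
    by (rule power2_eq_imp_eq) simp_all
qed

text \<open>Were H zero, the empty set would span it, against infinite dimension; a nonzero vector
  is then normalised.\<close>

lemma unit_vector_exists:
  assumes "infinite_dimensional TYPE('h::chilbert_space)"
  obtains e :: "'h::chilbert_space" where "norm e = 1"
proof -
  have "\<exists>x::'h. x \<noteq> 0"
  proof (rule ccontr)
    assume "\<nexists>x::'h. x \<noteq> 0"
    then have "complex_vector.span {} = (UNIV :: 'h set)" by auto
    then show False using assms unfolding infinite_dimensional_def by blast
  qed
  then obtain x :: 'h where "x \<noteq> 0" by blast
  then have "norm (complex_of_real (inverse (norm x)) *\<^sub>C x) = 1"
    by (simp add: norm_scaleC norm_inverse)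
  then show ?thesis by (rule that)
qed

theorem theorem4p7:
  fixes j :: "('h::chilbert_space, 'h) tensor \<Rightarrow> 'k::chilbert_space"
    and \<iota> :: "'k \<Rightarrow> 'h"
    and NE :: "('h, 'e::complex_vector) tensor \<Rightarrow> real"
    and NF :: "('h, 'f::complex_vector) tensor \<Rightarrow> real"
  assumes "separable_space (euclidean :: 'h topology)"
    and "infinite_dimensional TYPE('h)"
    and "hilbert_tensor_square j"
    and "unitary \<iota>"
    and "PL_norm NE"
    and "PL_norm NF"
  shows "PL_norm (pl_norm (diamond j \<iota>) NE NF)
    \<and> L_contractive_bilinear (diamond j \<iota>) NE NF (pl_norm (diamond j \<iota>) NE NF) (\<otimes>)
    \<and> (\<forall>(NG :: ('h, 'g::complex_vector) tensor \<Rightarrow> real) \<R>.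
        PL_norm NG \<and> L_bounded_bilinear (diamond j \<iota>) NE NF NG \<R> \<longrightarrow>
        (\<exists>!R. L_bounded (pl_norm (diamond j \<iota>) NE NF) NG R \<and> (\<forall>x y. R (x \<otimes> y) = \<R> x y))
      \<and> (\<forall>R. L_bounded (pl_norm (diamond j \<iota>) NE NF) NG R \<and> (\<forall>x y. R (x \<otimes> y) = \<R> x y) \<longrightarrow>
          lb_norm (pl_norm (diamond j \<iota>) NE NF) NG R = lb_norm_bilinear (diamond j \<iota>) NE NF NG \<R>))"
proof -
  obtain e :: 'h where e: "norm e = 1" using unit_vector_exists[OF assms(2)] by blast
  interpret pl_tensor "diamond j \<iota>" NE NF e
    using diamond[OF assms(3,4)] assms(5,6) e by unfold_locales
  show ?thesis
  proof (intro conjI allI impI PL_norm_pl L_contractive_tensor_elem; elim conjE)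
    fix NG :: "('h, 'g) tensor \<Rightarrow> real" and \<R>
    assume NG: "PL_norm NG" and \<R>: "L_bounded_bilinear (diamond j \<iota>) NE NF NG \<R>"
    show "\<exists>!R. L_bounded pl NG R \<and> (\<forall>x y. R (x \<otimes> y) = \<R> x y)"
      by (rule universal_property[OF NG \<R>])
    show "lb_norm pl NG R = lb_norm_bilinear (diamond j \<iota>) NE NF NG \<R>"
      if "L_bounded pl NG R" "\<forall>x y. R (x \<otimes> y) = \<R> x y" for R
      using that by (intro lb_norm_eq[OF NG \<R>]) (auto simp: L_bounded_def)
  qed
qed

end
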